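(* For every $d\ge1$, $$\sum_{n<x}L_d(n)\le x^{d-1}\sum_{n<x}L_1(n)\le x^{d+1}\mathcal{L}(x)^{-1+o(1)}$$ as $x\to\infty$, where the sums are over odd composite integers $n<x$.
   Context: $\mathcal{L}(x)=\exp\left(\frac{\log x\,\log\log\log x}{\log\log x}\right)$, and $o(1)$ stands for a function of $x$ tending to $0$ as $x\to\infty$. For monic polynomials $g_1,g_2$ over $\mathbb{Z}/n\mathbb{Z}$, $\operatorname{gcmd}_n(g_1,g_2)$ is the monic polynomial generating the ideal $(g_1,g_2)$ of $(\mathbb{Z}/n\mathbb{Z})[x]$, if it exists. Let $n>1$ be odd and $f$ monic of degree $d$ over $\mathbb{Z}/n\mathbb{Z}$ with $\gcd(n,f(0)\Delta_f)=1$ ($\Delta_f$ the discriminant). Factorization step: put $f_0=f$, and for $i\ge1$ let $F_i=\operatorname{gcmd}_n(x^{n^i}-x,f_{i-1})$, $f_i=f_{i-1}/F_i$; the pair $(f,n)$ passes if all these gcmd's exist and $f_d=1$. Frobenius step: $F_i(x^n)\equiv0\pmod{(n,F_i(x))}$ for $2\le i\le d$. Jacobi step: $(-1)^S=\left(\frac{\Delta_f}{n}\right)$ with $S=\sum_{2\mid i}\deg(F_i)/i$. $(f,n)$ is a Frobenius pseudoprime if it passes all three steps. $L_d(n)$ is the number of monic polynomials $f$ modulo $n$ of degree $d$ such that $(f,n)$ is a Frobenius pseudoprime. *)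

theory Defs
  imports
    Complex_Main
    "HOL-Number_Theory.Number_Theory"
    "Subresultants.Resultant_Prelim"
    "Berlekamp_Zassenhaus.Poly_Mod"
begin

text \<open>
  Elements of \<open>(\<int>/n\<int>)[x]\<close> are represented by integer polynomials with coefficients in
  \<open>{0..<n}\<close>, i.e. by the fixed points of \<open>poly_mod.Mp n\<close>, as in the locale \<open>poly_mod\<close>.
\<close>

definition monic_mod :: "nat \<Rightarrow> int poly \<Rightarrow> bool" where
  "monic_mod n f \<longleftrightarrow> poly_mod.Mp (int n) f = f \<and> monic f"

definition ideal_mod :: "nat \<Rightarrow> int poly \<Rightarrow> int poly \<Rightarrow> int poly set" where
  "ideal_mod n g1 g2 = {poly_mod.Mp (int n) (u * g1 + v * g2) |u v. True}"

definition principal_ideal_mod :: "nat \<Rightarrow> int poly \<Rightarrow> int poly set" where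
  "principal_ideal_mod n h = {poly_mod.Mp (int n) (u * h) |u. True}"

definition is_gcmd :: "nat \<Rightarrow> int poly \<Rightarrow> int poly \<Rightarrow> int poly \<Rightarrow> bool" where
  "is_gcmd n g1 g2 h \<longleftrightarrow> monic_mod n h \<and> principal_ideal_mod n h = ideal_mod n g1 g2"

definition gcmd_exists :: "nat \<Rightarrow> int poly \<Rightarrow> int poly \<Rightarrow> bool" where
  "gcmd_exists n g1 g2 \<longleftrightarrow> (\<exists>h. is_gcmd n g1 g2 h)"

definition gcmd :: "nat \<Rightarrow> int poly \<Rightarrow> int poly \<Rightarrow> int poly" where
  "gcmd n g1 g2 = (THE h. is_gcmd n g1 g2 h)"

lemma is_gcmd_unique:
  assumes n: "n > 1" and h: "is_gcmd n g1 g2 h" and k: "is_gcmd n g1 g2 k"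
  shows "h = k"
proof -
  interpret poly_mod "int n" .
  have dv: "\<exists>u. Mp u = u \<and> monic u \<and> b = Mp (u * a) \<and> degree b = degree u + degree a"
    if a: "is_gcmd n g1 g2 a" and b: "is_gcmd n g1 g2 b" for a b
  proof -
    have ma: "Mp a = a" "monic a" and mb: "Mp b = b" "monic b"
      using a b by (auto simp: is_gcmd_def monic_mod_def)
    have "b \<in> principal_ideal_mod n b"
      using mb unfolding principal_ideal_mod_def by (auto intro!: exI[of _ 1])
    hence "b \<in> principal_ideal_mod n a"
      using a b by (simp add: is_gcmd_def)
    then obtain u0 where u0: "b = Mp (u0 * a)" unfolding principal_ideal_mod_def by auto
    define u where "u = Mp u0"
    have u: "Mp u = u" and bu: "b = Mp (u * a)" by (simp_all add: u_def u0)
    have u_ne: "u \<noteq> 0" using bu mb by auto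
    have a_ne: "a \<noteq> 0" using ma by auto
    have c: "coeff (u * a) (degree u + degree a) = lead_coeff u"
      using ma by (simp add: coeff_mult_degree_sum)
    have lu: "M (lead_coeff u) = lead_coeff u"
      using u by (metis Mp_coeff)
    have cb: "coeff b (degree u + degree a) = lead_coeff u"
      by (simp add: bu Mp_coeff c lu)
    have d1: "degree b \<ge> degree u + degree a"
      using cb u_ne by (intro le_degree) simp
    have d2: "degree b \<le> degree u + degree a"
      unfolding bu using degree_m_le_degree[of "u * a"] degree_mult_eq[OF u_ne a_ne] by simp
    have d: "degree b = degree u + degree a" using d1 d2 by simp
    show ?thesis using u bu d cb mb by (intro exI[of _ u]) auto
  qed
  obtain u where u: "monic u" "k = Mp (u * h)" "degree k = degree u + degree h"
    using dv[OF h k] by auto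
  obtain v :: "int poly" where v: "degree h = degree v + degree k"
    using dv[OF k h] by auto
  have "degree u = 0" using u v by simp
  with u have "u = 1" by (metis monic_degree_0)
  with u h show ?thesis by (simp add: is_gcmd_def monic_mod_def)
qed

lemma gcmd_eq: "n > 1 \<Longrightarrow> is_gcmd n g1 g2 h \<Longrightarrow> gcmd n g1 g2 = h"
  unfolding gcmd_def by (blast intro: is_gcmd_unique)

text \<open>
  Division by a monic polynomial. Pseudo-division of \<open>f\<close> by \<open>g\<close> divides a multiple of \<open>f\<close> by a power of
  the leading coefficient of \<open>g\<close>, so for monic \<open>g\<close> its quotient is the Euclidean quotient.
\<close>

definition quotient_mod :: "nat \<Rightarrow> int poly \<Rightarrow> int poly \<Rightarrow> int poly" where
  "quotient_mod n f g = poly_mod.Mp (int n) (fst (pseudo_divmod f g))"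

lemma quotient_mod_unique:
  assumes n: "n > 1" and g: "monic_mod n g" and q: "poly_mod.Mp (int n) q = q"
    and f: "f = poly_mod.Mp (int n) (q * g)"
  shows "quotient_mod n f g = q"
proof -
  interpret poly_mod "int n" .
  have g': "monic g" "g \<noteq> 0" using g by (auto simp: monic_mod_def)
  obtain Q R where QR: "pseudo_divmod f g = (Q, R)" by force
  have eq: "f = g * Q + R" and R: "R = 0 \<or> degree R < degree g"
    using pseudo_divmod[OF g'(2) QR] g' by auto
  define w where "w = Mp (q - Q)"
  have "Mp (f - g * Q) = Mp (q * g - g * Q)"
    using minus_Mp(1)[of "q * g" "g * Q"] f by simp
  also have "\<dots> = Mp (w * g)" by (simp add: w_def algebra_simps)
  finally have wR: "Mp (w * g) = Mp R" using eq by simp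
  have "w = 0"
  proof (rule ccontr)
    assume "w \<noteq> 0"
    have "coeff (Mp (w * g)) (degree w + degree g) = M (lead_coeff w)"
      using g' by (simp add: Mp_coeff coeff_mult_degree_sum)
    also have "\<dots> = lead_coeff w" by (metis Mp_coeff Mp_Mp w_def)
    finally have "M (coeff R (degree w + degree g)) \<noteq> 0"
      using \<open>w \<noteq> 0\<close> by (simp add: wR Mp_coeff)
    moreover have "coeff R (degree w + degree g) = 0"
      using R by (auto intro: coeff_eq_0)
    ultimately show False by simp
  qed
  have "Mp q = Mp (w + Q)"
    by (simp add: w_def)
  with \<open>w = 0\<close> q have "Mp Q = q" by simp
  thus ?thesis by (simp add: quotient_mod_def QR)
qed

definition frob_poly :: "nat \<Rightarrow> nat \<Rightarrow> int poly" where
  "frob_poly n i = monom 1 (n ^ i) - monom 1 1"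

text \<open>\<open>cofactor n f i\<close> is \<open>f\<^sub>i\<close> and \<open>factor n f i\<close> is \<open>F\<^sub>i\<close> (for \<open>i \<ge> 1\<close>).\<close>

fun cofactor :: "nat \<Rightarrow> int poly \<Rightarrow> nat \<Rightarrow> int poly" where
  "cofactor n f 0 = f"
| "cofactor n f (Suc i) =
     quotient_mod n (cofactor n f i) (gcmd n (frob_poly n (Suc i)) (cofactor n f i))"

definition factor :: "nat \<Rightarrow> int poly \<Rightarrow> nat \<Rightarrow> int poly" where
  "factor n f i = gcmd n (frob_poly n i) (cofactor n f (i - 1))"

definition factorization_step :: "int poly \<Rightarrow> nat \<Rightarrow> bool" where
  "factorization_step f n \<longleftrightarrow>
     (\<forall>i\<in>{1..degree f}. gcmd_exists n (frob_poly n i) (cofactor n f (i - 1))) \<and>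
     cofactor n f (degree f) = 1"

definition frobenius_step :: "int poly \<Rightarrow> nat \<Rightarrow> bool" where
  "frobenius_step f n \<longleftrightarrow>
     (\<forall>i\<in>{2..degree f}.
        poly_mod.dvdm (int n) (factor n f i) (pcompose (factor n f i) (monom 1 n)))"

text \<open>
  The discriminant of a monic polynomial. For \<open>f\<close> monic modulo \<open>n\<close> it is applied to the integer
  representative of \<open>f\<close>; there \<open>pderiv f\<close> has degree exactly \<open>degree f - 1\<close>, and the result reduces
  modulo \<open>n\<close> to the discriminant of \<open>f\<close> over \<open>\<int>/n\<int>\<close>, even if \<open>n\<close> and \<open>degree f\<close> have a common factor.
\<close>

definition discriminant :: "int poly \<Rightarrow> int" where
  "discriminant f = (- 1) ^ (degree f * (degree f - 1) div 2) * resultant f (pderiv f)"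

definition Jacobi :: "int \<Rightarrow> nat \<Rightarrow> int" where
  "Jacobi a n = (\<Prod>p\<in>#prime_factorization n. Legendre a (int p))"

text \<open>
  The divisions \<open>degree F\<^sub>i div i\<close> are exact whenever the two preceding steps are passed.
\<close>

definition jacobi_step :: "int poly \<Rightarrow> nat \<Rightarrow> bool" where
  "jacobi_step f n \<longleftrightarrow>
     (- 1) ^ (\<Sum>i | i \<in> {1..degree f} \<and> even i. degree (factor n f i) div i)
       = Jacobi (discriminant f) n"

definition frobenius_pseudoprime :: "int poly \<Rightarrow> nat \<Rightarrow> bool" where
  "frobenius_pseudoprime f n \<longleftrightarrow>
     n > 1 \<and> odd n \<and> monic_mod n f \<and> coprime (int n) (poly f 0 * discriminant f) \<and>
     factorization_step f n \<and> frobenius_step f n \<and> jacobi_step f n"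

definition L :: "nat \<Rightarrow> nat \<Rightarrow> nat" where
  "L d n = card {f. monic_mod n f \<and> degree f = d \<and> frobenius_pseudoprime f n}"

definition odd_composites_below :: "real \<Rightarrow> nat set" where
  "odd_composites_below x = {n. odd n \<and> n > 1 \<and> \<not> prime n \<and> real n < x}"

definition script_L :: "real \<Rightarrow> real" where
  "script_L x = exp (ln x * ln (ln (ln x)) / ln (ln x))"

end

theory Submission
  imports Defs "HOL-Real_Asymp.Real_Asymp"
begin

text \<open>
  Let \<open>F n\<close> be the number of bases \<open>a\<close> modulo \<open>n\<close> with \<open>a ^ (n - 1) \<equiv> 1\<close>; then \<open>L 1 n = F n\<close>.

  First inequality. On \<open>(\<int>/n\<int>)[x]/(F\<^sub>i)\<close>, the factorization and Frobenius steps make \<open>\<sigma>: x \<mapsto> x\<^sup>n\<close> an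
  automorphism of finite order. If \<open>C\<close> and \<open>S\<close> are the matrices of multiplication by \<open>x\<close> and of \<open>\<sigma>\<close>, then
  \<open>C S = S C\<^sup>n\<close>, and comparing determinants shows that \<open>c = det C = \<plusminus> F\<^sub>i(0)\<close> satisfies \<open>c\<^sup>n = c\<close>. As
  \<open>f(0)\<close> is the product of the \<open>F\<^sub>i(0)\<close>, it is a base counted by \<open>F n\<close>; the other \<open>d - 1\<close> coefficients
  can take at most \<open>n\<close> values each.

  Second inequality (after Erdos and Pomerance). Let \<open>K\<close> be the index of the group of bases, so that
  \<open>F n = totient n / K\<close>, and let \<open>\<psi>(n)\<close> be the lcm of the \<open>p - 1\<close> over the prime factors \<open>p\<close> of \<open>n\<close>; then
  \<open>\<psi>(n)\<close> divides \<open>K (n - 1)\<close>.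
  Let \<open>\<Lambda> = script_L x\<close>. Integers with \<open>F n \<le> x / \<Lambda>\<close> are harmless. For the others \<open>K < \<Lambda>\<close>, and \<open>n\<close> has
  either a prime factor \<open>p > \<Lambda>\<^sup>2\<close> or a divisor \<open>d\<close> in \<open>(x / \<Lambda>\<^sup>3, x / \<Lambda>]\<close>. In both cases \<open>n\<close> is a
  multiple of \<open>p\<close> (or \<open>d\<close>) congruent to 1 modulo \<open>(p - 1) / k\<close> (or \<open>\<psi>(d) / k\<close>) for some \<open>k \<le> K\<close>, and one
  counts residue classes. The sum over \<open>d\<close> is controlled by Rankin's bound for the number of \<open>d\<close> with
  \<open>\<psi>(d) = m\<close>, with exponent \<open>1 - (1 - \<epsilon>) log log log x / log log x\<close>.
\<close>

text \<open>
  The names \<open>coprime\<close> and \<open>order\<close> would otherwise refer to the constants of \<open>Unique_Factorization\<close>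
  and \<open>Polynomial\<close>; \<open>Defs\<close> uses the former.
\<close>

hide_const (open) Unique_Factorization.comm_monoid_mult_class.coprime
hide_const (open) Polynomial.order

subsection \<open>Sums over integers with restricted prime factors\<close>

lemma sum_le_sum_cover:
  fixes g :: "'a \<Rightarrow> real"
  assumes "finite I" "\<And>i. i \<in> I \<Longrightarrow> finite (S i)" "B \<subseteq> (\<Union>i\<in>I. S i)"
    and "\<And>i n. i \<in> I \<Longrightarrow> n \<in> S i \<Longrightarrow> g n \<ge> 0"
  shows "sum g B \<le> (\<Sum>i\<in>I. sum g (S i))"
proof -
  have "sum g B \<le> sum g (\<Union>i\<in>I. S i)"
    using assms by (intro sum_mono2) auto
  also have "\<dots> \<le> (\<Sum>i\<in>I. sum g (S i))"
    using assms(1,2,4)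
  proof (induction I rule: finite_induct)
    case (insert i I)
    have "sum g (S i \<union> (\<Union>i\<in>I. S i)) \<le> sum g (S i) + sum g (\<Union>i\<in>I. S i)"
      using insert by (subst sum_Un) (auto intro!: sum_nonneg)
    with insert show ?case by force
  qed simp
  finally show ?thesis .
qed

text \<open>Induction on \<open>P\<close>: splitting off the full \<open>p\<close>-part maps
  \<open>D\<close> injectively to pairs of an exponent and an integer composed of the remaining
  primes. On the full rectangle of such pairs the sum is a product, and the exponents contribute at
  most a geometric series.\<close>

lemma sum_powr_le_euler_product:
  fixes s :: real
  assumes "finite P" "\<And>p. p \<in> P \<Longrightarrow> prime p" "finite D" "0 \<notin> D"
    and "\<And>d. d \<in> D \<Longrightarrow> prime_factors d \<subseteq> P" and s: "s > 0"
  shows "(\<Sum>d\<in>D. real d powr -s) \<le> (\<Prod>p\<in>P. 1 / (1 - real p powr -s))"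
  using assms(1-5)
proof (induction P arbitrary: D rule: finite_induct)
  case empty
  have "D \<subseteq> {1}"
  proof
    fix d assume "d \<in> D"
    hence "d \<noteq> 0" "prime_factors d = {}" using empty.prems(3,4) by (metis, blast)
    thus "d \<in> {1}" by (auto simp: prime_factorization_empty_iff)
  qed
  hence "D = {} \<or> D = {1}" by auto
  thus ?case by auto
next
  case (insert p P)
  have p: "prime p" using insert by auto
  define f where "f d = d div p ^ multiplicity p d" for d :: nat
  define D' where "D' = f ` D"
  define J where "J = Max (insert 0 (multiplicity p ` D))"
  have dec: "d = p ^ multiplicity p d * f d" for d
    using multiplicity_dvd[of p d] by (simp add: f_def)
  have fnz: "f d \<noteq> 0" if "d \<in> D" for d using dec[of d] insert.prems that by (metis mult_zero_right)
  have pf: "prime_factors (f d) \<subseteq> P" if "d \<in> D" for d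
  proof
    fix q assume q: "q \<in> prime_factors (f d)"
    have "\<not> p dvd f d"
      unfolding f_def using that insert.prems(3) p
      by (intro multiplicity_decompose) (auto dest: not_prime_unit intro!: Nat.gr0I)
    moreover have "q dvd d" using q dec[of d] by (metis dvd_mult in_prime_factors_iff)
    hence "q \<in> prime_factors d" using q that insert.prems
      by (metis in_prime_factors_iff)
    ultimately show "q \<in> P" using insert.prems(4)[OF that] q by auto
  qed
  have le: "multiplicity p d \<le> J" if "d \<in> D" for d
    unfolding J_def using insert.prems that by (intro Max_ge) auto
  define q where "q = real p powr -s"
  have q: "0 < q" "q < 1"
    using prime_gt_1_nat[OF p] s by (auto simp: q_def powr_less_one)
  have IH: "(\<Sum>d\<in>D'. real d powr -s) \<le> (\<Prod>p\<in>P. 1 / (1 - real p powr -s))"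
  proof (rule insert.IH)
    show "prime_factors d \<subseteq> P" if "d \<in> D'" for d
      using pf that by (auto simp only: D'_def)
    show "0 \<notin> D'"
      using fnz unfolding D'_def by (metis imageE)
  qed (use insert.prems in \<open>auto simp: D'_def\<close>)
  have inj: "inj_on (\<lambda>d. (multiplicity p d, f d)) D"
  proof (rule inj_onI)
    fix a b assume "(multiplicity p a, f a) = (multiplicity p b, f b)"
    with dec[of a] dec[of b] show "a = b" by simp
  qed
  have "(\<Sum>d\<in>D. real d powr -s) = (\<Sum>d\<in>D. q ^ multiplicity p d * real (f d) powr -s)"
  proof (rule sum.cong[OF refl])
    fix d assume "d \<in> D"
    have "real d powr -s = (real p ^ multiplicity p d * real (f d)) powr -s"
      by (subst dec[of d]) simp
    also have "\<dots> = (real p ^ multiplicity p d) powr -s * real (f d) powr -s"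
      by (simp add: powr_mult)
    also have "(real p ^ multiplicity p d) powr -s = q ^ multiplicity p d"
      using prime_gt_0_nat[OF p]
      by (simp add: q_def powr_powr flip: powr_realpow) (simp add: powr_powr mult.commute)
    finally show "real d powr -s = q ^ multiplicity p d * real (f d) powr -s" .
  qed
  also have "\<dots> = (\<Sum>(j,e)\<in>(\<lambda>d. (multiplicity p d, f d)) ` D. q ^ j * real e powr -s)"
    by (subst sum.reindex[OF inj]) simp
  also have "\<dots> \<le> (\<Sum>(j,e)\<in>{..J} \<times> D'. q ^ j * real e powr -s)"
    using insert.prems le q by (intro sum_mono2) (auto simp: D'_def)
  also have "\<dots> = (\<Sum>j\<le>J. q ^ j) * (\<Sum>d\<in>D'. real d powr -s)"
    by (simp add: sum_product sum.cartesian_product)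
  also have "\<dots> \<le> (1 / (1 - q)) * (\<Prod>p\<in>P. 1 / (1 - real p powr -s))"
  proof (rule mult_mono[OF _ IH])
    have "(\<Sum>j\<le>J. q ^ j) \<le> (\<Sum>j. q ^ j)"
      using q by (intro sum_le_suminf summable_geometric) auto
    thus "(\<Sum>j\<le>J. q ^ j) \<le> 1 / (1 - q)" using q by (simp add: suminf_geometric)
  qed (use q in \<open>auto intro!: sum_nonneg\<close>)
  finally show ?case using insert by (simp add: q_def)
qed

text \<open>The factor 4 comes from \<open>1 - t \<ge> 1/4\<close>. The range covers
  \<open>t = p powr -s\<close> for primes \<open>p\<close> and \<open>s \<ge> 1/2\<close>, because 1
  / sqrt 2 is below 3/4.\<close>

lemma inverse_one_minus_le_exp:
  fixes t :: real
  assumes "0 \<le> t" "t \<le> 3/4"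
  shows "1 / (1 - t) \<le> exp (4 * t)"
proof -
  have "1 / (1 - t) = 1 + t / (1 - t)" using assms by (simp add: field_simps)
  also have "t / (1 - t) \<le> 4 * t"
  proof -
    have "t * 1 \<le> t * (4 * (1 - t))" using assms by (intro mult_left_mono) auto
    thus ?thesis using assms by (simp add: divide_simps mult_ac)
  qed
  also have "1 + 4 * t \<le> exp (4 * t)" by (rule exp_ge_add_one_self)
  finally show ?thesis by simp
qed

lemma sum_powr_le_exp:
  fixes s :: real
  assumes "finite P" "\<And>p. p \<in> P \<Longrightarrow> prime p" "finite D" "0 \<notin> D"
    and "\<And>d. d \<in> D \<Longrightarrow> prime_factors d \<subseteq> P" and s: "s \<ge> 1/2"
  shows "(\<Sum>d\<in>D. real d powr -s) \<le> exp (4 * (\<Sum>p\<in>P. real p powr -s))"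
proof -
  have "(\<Sum>d\<in>D. real d powr -s) \<le> (\<Prod>p\<in>P. 1 / (1 - real p powr -s))"
    using assms by (intro sum_powr_le_euler_product) auto
  also have "\<dots> \<le> (\<Prod>p\<in>P. exp (4 * real p powr -s))"
  proof (rule prod_mono, safe)
    fix p assume "p \<in> P"
    hence p: "real p \<ge> 2" using assms(2) prime_ge_2_nat[of p] by simp
    have "real p powr -s \<le> 2 powr -s" using p s by (intro powr_mono2') auto
    also have "\<dots> \<le> 2 powr -(1/2)" using s by (intro powr_mono) auto
    also have "\<dots> \<le> 3/4"
    proof -
      have "4/3 \<le> sqrt (2::real)" by (rule real_le_rsqrt) (simp add: power2_eq_square)
      thus ?thesis by (simp add: powr_minus powr_half_sqrt divide_simps)
    qed
    finally have *: "real p powr -s \<le> 3/4" .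
    thus "0 \<le> 1 / (1 - real p powr -s)" by simp
    show "1 / (1 - real p powr -s) \<le> exp (4 * real p powr -s)"
      using * by (intro inverse_one_minus_le_exp) auto
  qed
  also have "\<dots> = exp (4 * (\<Sum>p\<in>P. real p powr -s))"
    using assms(1) by (simp add: exp_sum sum_distrib_left)
  finally show ?thesis .
qed

section \<open>Harmonic sums and reciprocals of primes\<close>

lemma harmonic_le:
  "(\<Sum>k=1..n. 1 / real k) \<le> 1 + ln (real (max 1 n))"
proof (induction n)
  case (Suc n)
  show ?case
  proof (cases "n = 0")
    case False
    have "ln (real n / real (Suc n)) \<le> real n / real (Suc n) - 1"
      using False by (intro ln_le_minus_one) simp
    also have "\<dots> = - 1 / real (Suc n)" by (simp add: field_simps)
    finally have "1 / real (Suc n) \<le> ln (real (Suc n)) - ln (real n)"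
      using False by (simp add: ln_div del: of_nat_Suc)
    with Suc False show ?thesis by (simp add: max_def del: of_nat_Suc split: if_splits)
  qed simp
qed simp

lemma prod_distinct_primes_dvd:
  assumes "finite P" "\<And>p. p \<in> P \<Longrightarrow> prime p" "\<And>p. p \<in> P \<Longrightarrow> p dvd n"
  shows "\<Prod>P dvd (n :: nat)"
  using assms
proof (induction P rule: finite_induct)
  case (insert p P)
  have "coprime p (\<Prod>P)"
    using insert by (intro prod_coprime_right) (metis insertCI primes_coprime)
  with insert show ?case by (simp add: divides_mult)
qed simp

text \<open>Chebyshev's argument: with \<open>m = 2 ^ k\<close>, every prime in (m, 2m] divides the
  central binomial coefficient, which is at most \<open>2 ^ (2 * m)\<close>, while each of these
  primes exceeds \<open>m\<close>.\<close>

lemma card_primes_dyadic: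
  "k * card {p::nat. prime p \<and> 2 ^ k < p \<and> p \<le> 2 ^ Suc k} \<le> 2 ^ Suc k"
proof -
  define m :: nat where "m = 2 ^ k"
  let ?P = "{p. prime p \<and> m < p \<and> p \<le> 2 * m}"
  have fin: "finite ?P" by (rule finite_subset[of _ "{..2*m}"]) auto
  have "\<Prod>?P dvd (2 * m choose m)"
  proof (rule prod_distinct_primes_dvd[OF fin])
    fix p assume "p \<in> ?P"
    hence p: "prime p" "m < p" "p \<le> 2 * m" by auto
    have "p dvd fact (2 * m)" using p by (simp add: prime_dvd_fact_iff)
    also have "fact (2 * m) = fact m * fact m * (2 * m choose m)"
      using binomial_fact_lemma[of m "2 * m"] by (simp add: mult_2)
    finally show "p dvd (2 * m choose m)"
      using p by (simp add: prime_dvd_mult_iff prime_dvd_fact_iff)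
  qed auto
  hence "\<Prod>?P \<le> (2 * m choose m)" by (rule dvd_imp_le) simp
  also have "\<dots> \<le> 2 ^ (2 * m)"
    by (metis choose_row_sum finite_atMost atMost_iff member_le_sum mult_2 le_add1 zero_le)
  finally have "\<Prod>?P \<le> 2 ^ (2 * m)" .
  moreover have "m ^ card ?P \<le> \<Prod>?P"
    using prod_mono[of ?P "\<lambda>_. m" "\<lambda>p. p"] by auto
  ultimately have "(2::nat) ^ (k * card ?P) \<le> 2 ^ (2 * m)" by (simp add: m_def power_mult)
  thus ?thesis by (simp add: m_def)
qed

text \<open>An upper bound of Mertens type by dyadic blocks: for \<open>j \<ge> 1\<close>, there are
  at most 2^(j+1) / j primes in (2^j, 2^(j+1)], which contribute at most 2 / j. The leading 1 covers
  the prime 2.\<close>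

lemma sum_inverse_primes_le:
  "(\<Sum>p | prime p \<and> p \<le> 2 ^ Suc K. 1 / real p) \<le> 1 + 2 * (\<Sum>k=1..K. 1 / real k)"
proof (induction K)
  case 0
  have "{p::nat. prime p \<and> p \<le> 2} = {2}" by (auto dest: prime_ge_2_nat)
  thus ?case by simp
next
  case (Suc k)
  let ?B = "{p::nat. prime p \<and> 2 ^ Suc k < p \<and> p \<le> 2 ^ Suc (Suc k)}"
  let ?A = "{p::nat. prime p \<and> p \<le> 2 ^ Suc k}"
  have fin: "finite ?A" "finite ?B"
    by (rule finite_subset[of _ "{..2 ^ Suc (Suc k)}"]; force)+
  have "(2::nat) ^ Suc k \<le> 2 ^ Suc (Suc k)" by simp
  hence "{p. prime p \<and> p \<le> 2 ^ Suc (Suc k)} = ?A \<union> ?B" by force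
  moreover have "?A \<inter> ?B = {}" by auto
  ultimately have eq: "(\<Sum>p | prime p \<and> p \<le> 2 ^ Suc (Suc k). 1 / real p)
      = (\<Sum>p\<in>?A. 1 / real p) + (\<Sum>p\<in>?B. 1 / real p)"
    using fin by (simp add: sum.union_disjoint)
  have "(\<Sum>p\<in>?B. 1 / real p) \<le> (\<Sum>p\<in>?B. 1 / 2 ^ Suc k)"
  proof (rule sum_mono)
    fix p assume "p \<in> ?B"
    hence "real (2 ^ Suc k) \<le> real p" by (intro of_nat_mono) auto
    hence "2 ^ Suc k \<le> real p" by simp
    moreover have "(0::real) < 2 ^ Suc k" by simp
    ultimately show "1 / real p \<le> 1 / 2 ^ Suc k" by (intro divide_left_mono mult_pos_pos) linarith+
  qed
  also have "\<dots> = real (card ?B) / 2 ^ Suc k" by simp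
  also have "\<dots> \<le> 2 / real (Suc k)"
  proof -
    have "real (Suc k * card ?B) \<le> real (2 ^ Suc (Suc k))"
      by (intro of_nat_mono card_primes_dyadic)
    hence "real (Suc k) * real (card ?B) \<le> 2 * 2 ^ Suc k" by (simp only: of_nat_mult of_nat_power) simp
    thus ?thesis by (simp add: divide_simps mult_ac del: of_nat_Suc power_Suc)
  qed
  finally have "(\<Sum>p\<in>?B. 1 / real p) \<le> 2 / real (Suc k)" .
  with Suc show ?case unfolding eq by (simp add: algebra_simps del: power_Suc)
qed

subsection \<open>Fermat bases\<close>

definition fermat_bases :: "nat \<Rightarrow> nat set" where
  "fermat_bases n = {a \<in> totatives n. [a ^ (n - 1) = 1] (mod n)}"

lemma finite_fermat_bases [simp]: "finite (fermat_bases n)"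
  by (simp add: fermat_bases_def)

lemma card_fermat_bases_pos: "n > 0 \<Longrightarrow> card (fermat_bases n) > 0"
  by (subst card_gt_0_iff) (auto simp: fermat_bases_def totatives_def intro!: exI[of _ 1])

lemma card_fermat_bases_le: "card (fermat_bases n) \<le> totient n"
  unfolding totient_def fermat_bases_def by (intro card_mono) auto

text \<open>The bases form a subgroup \<open>H\<close> of the unit group, the kernel of the power
  map with exponent \<open>n - 1\<close>. With \<open>K\<close> the index of \<open>H\<close>,
  Lagrange's theorem gives the first claim; in the quotient group of order \<open>K\<close> it shows
  that the \<open>K\<close>-th power of every unit lies in \<open>H\<close>, which gives the
  second.\<close>

lemma fermat_bases_index:
  assumes n: "n > 1"
  obtains K where "totient n = K * card (fermat_bases n)"
    "\<And>a. coprime a n \<Longrightarrow> [a ^ (K * (n - 1)) = 1] (mod n)"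
proof -
  define R where "R = residue_ring (int n)"
  interpret residues "int n" R by unfold_locales (use n in \<open>auto simp: R_def\<close>)
  define G where "G = units_of R"
  interpret G: comm_group G unfolding G_def by (rule units_comm_group)
  have carG: "carrier G = {x. 0 < x \<and> x < int n \<and> coprime x (int n)}"
    by (simp add: G_def units_of_carrier res_units_eq)
  have pow: "int a [^]\<^bsub>G\<^esub> (k::nat) = int (a ^ k mod n)" if "int a \<in> carrier G" for a k
  proof -
    have "int a [^]\<^bsub>G\<^esub> k = int a [^]\<^bsub>R\<^esub> k"
      using that units_of_pow[of "int a" k] by (simp add: G_def units_of_carrier)
    also have "\<dots> = (int a mod int n) [^]\<^bsub>R\<^esub> k" using that carG by simp
    finally show ?thesis by (simp add: pow_cong zmod_int)
  qed
  have oneG: "\<one>\<^bsub>G\<^esub> = 1" by (simp add: G_def units_of_one res_one_eq)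
  define H where "H = {x \<in> carrier G. x [^]\<^bsub>G\<^esub> (n - 1) = \<one>\<^bsub>G\<^esub>}"
  have subH: "subgroup H G"
  proof
    show "x \<otimes>\<^bsub>G\<^esub> y \<in> H" if "x \<in> H" "y \<in> H" for x y
      using that by (simp add: H_def G.nat_pow_distrib)
    show "inv\<^bsub>G\<^esub> x \<in> H" if "x \<in> H" for x
      using that by (simp add: H_def G.nat_pow_inv)
  qed (auto simp: H_def)
  interpret normal H G by (rule G.subgroup_imp_normal[OF subH])
  define K where "K = card (rcosets\<^bsub>G\<^esub> H)"
  interpret Q: group "G Mod H" by (rule factorgroup_is_group)
  have "H = int ` fermat_bases n"
  proof (intro equalityI subsetI)
    fix x assume x: "x \<in> H"
    define a where "a = nat x"
    have a: "x = int a" "int a \<in> carrier G" using x by (auto simp: H_def carG a_def)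
    have "int (a ^ (n - 1) mod n) = int a [^]\<^bsub>G\<^esub> (n - 1)" using pow[OF a(2)] by simp
    also have "\<dots> = 1" using x unfolding a(1) H_def oneG by blast
    finally have "a ^ (n - 1) mod n = 1" by simp
    moreover have "0 < a" "a \<le> n" "coprime a n" using a(2) by (simp_all add: carG)
    ultimately have "a \<in> fermat_bases n" using n
      by (simp add: fermat_bases_def unique_euclidean_semiring_class.cong_def totatives_def)
    thus "x \<in> int ` fermat_bases n" using a by auto
  next
    fix x assume "x \<in> int ` fermat_bases n"
    then obtain a where a: "x = int a" "a \<in> fermat_bases n" by auto
    have "a \<noteq> n" using a n by (auto simp: fermat_bases_def totatives_def)
    hence "int a \<in> carrier G" using a n by (auto simp: carG fermat_bases_def totatives_def)
    moreover have "a ^ (n - 1) mod n = 1"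
      using a(2) n by (simp add: fermat_bases_def unique_euclidean_semiring_class.cong_def)
    hence "int a [^]\<^bsub>G\<^esub> (n - 1) = 1" using pow[OF \<open>int a \<in> carrier G\<close>, of "n - 1"] by simp
    ultimately show "x \<in> H" unfolding H_def oneG a(1) by blast
  qed
  hence cardH: "card H = card (fermat_bases n)" by (simp add: card_image)
  have cardG: "order G = totient n"
    using totient_eq by (simp add: Coset.order_def G_def units_of_carrier)
  show ?thesis
  proof
    show "totient n = K * card (fermat_bases n)"
      using G.lagrange[OF subH] cardH cardG by (simp add: K_def)
  next
    fix a :: nat assume "coprime a n"
    define b where "b = a mod n"
    have cb: "coprime b n" using \<open>coprime a n\<close> n by (simp add: b_def)
    have "b \<noteq> 0" using cb n by (cases "b = 0") auto
    hence b: "int b \<in> carrier G" using n cb by (auto simp: carG b_def)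
    interpret h: group_hom G "G Mod H" "\<lambda>a. H #>\<^bsub>G\<^esub> a"
      by unfold_locales (rule r_coset_hom_Mod)
    have "H #>\<^bsub>G\<^esub> (int b [^]\<^bsub>G\<^esub> K) = (H #>\<^bsub>G\<^esub> int b) [^]\<^bsub>G Mod H\<^esub> K"
      using b by (simp add: h.hom_nat_pow)
    also have "\<dots> = \<one>\<^bsub>G Mod H\<^esub>"
      using Q.pow_order_eq_1[of "H #>\<^bsub>G\<^esub> int b"] h.hom_closed[OF b]
      by (simp add: K_def Coset.order_def FactGroup_def)
    also have "\<dots> = H" by (simp add: FactGroup_def)
    finally have "int b [^]\<^bsub>G\<^esub> K \<in> H"
      using G.rcos_self[OF G.nat_pow_closed[OF b, of K] subH] by metis
    hence "(int b [^]\<^bsub>G\<^esub> K) [^]\<^bsub>G\<^esub> (n - 1) = 1"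
      unfolding H_def oneG by blast
    hence "int b [^]\<^bsub>G\<^esub> (K * (n - 1)) = 1"
      by (simp only: G.nat_pow_pow[OF b])
    hence "b ^ (K * (n - 1)) mod n = 1"
      by (simp only: pow[OF b] of_nat_eq_1_iff)
    hence "a ^ (K * (n - 1)) mod n = 1"
      unfolding b_def by (simp only: power_mod)
    thus "[a ^ (K * (n - 1)) = 1] (mod n)"
      using n by (simp only: unique_euclidean_semiring_class.cong_def mod_less)
  qed
qed

text \<open>Unlike Carmichael's function it ignores the exponents of the primes. At
  \<open>n = 1\<close> it is the empty \<open>LCM\<close>, that is 1.\<close>

definition lcm_pred_primes :: "nat \<Rightarrow> nat" where
  "lcm_pred_primes n = (LCM p\<in>prime_factors n. p - 1)"

lemma lcm_pred_primes_mono: "d dvd n \<Longrightarrow> n > 0 \<Longrightarrow> lcm_pred_primes d dvd lcm_pred_primes n"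
  unfolding lcm_pred_primes_def by (intro Lcm_subset image_mono dvd_prime_factors) auto

lemma prime_minus_1_dvd_lcm_pred_primes: "prime p \<Longrightarrow> p dvd n \<Longrightarrow> n > 0 \<Longrightarrow> p - 1 dvd lcm_pred_primes n"
  unfolding lcm_pred_primes_def by (intro dvd_Lcm imageI) (auto simp: in_prime_factors_iff)

lemma lcm_pred_primes_dvd_Carmichael:
  assumes "n > 0"
  shows "lcm_pred_primes n dvd Carmichael n"
  unfolding lcm_pred_primes_def
proof (rule Lcm_least, safe)
  fix p assume "p \<in> prime_factors n"
  hence p: "prime p" "p dvd n" by auto
  obtain m where m: "n = p ^ multiplicity p n * m" "\<not> p dvd m"
    using multiplicity_decompose'[of n p] p assms by (metis not_prime_unit gr_implies_not0)
  have k: "multiplicity p n > 0" using p assms by (simp add: prime_multiplicity_gt_zero_iff)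
  have "coprime (p ^ multiplicity p n) m"
    using m p by (simp add: prime_imp_coprime)
  hence "Carmichael n = lcm (Carmichael (p ^ multiplicity p n)) (Carmichael m)"
    using Carmichael_mult_coprime m(1) by metis
  moreover have "p - 1 dvd Carmichael (p ^ multiplicity p n)"
  proof (cases "p = 2")
    case False
    hence "odd p" using p primes_dvd_imp_eq two_is_prime_nat by blast
    thus ?thesis using Carmichael_odd_prime_power[OF p(1), of "multiplicity p n"] k by simp
  qed simp
  ultimately show "p - 1 dvd Carmichael n" by (simp only: dvd_trans[OF _ dvd_lcm1])
qed

lemma lcm_pred_primes_pos: "n > 0 \<Longrightarrow> lcm_pred_primes n > 0"
  using lcm_pred_primes_dvd_Carmichael[of n] by (metis Carmichael_pos dvd_pos_nat)

lemma lcm_pred_primes_le: "n > 0 \<Longrightarrow> lcm_pred_primes n \<le> n"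
  using dvd_imp_le[OF dvd_trans[OF lcm_pred_primes_dvd_Carmichael Carmichael_dvd_totient, of n]] totient_le[of n]
  by simp

text \<open>The index \<open>K\<close> of the group of bases in the unit group; for
  \<open>n > 1\<close> the division is exact.\<close>

definition fermat_index :: "nat \<Rightarrow> nat" where
  "fermat_index n = totient n div card (fermat_bases n)"

text \<open>The exponent \<open>K * (n - 1)\<close> annihilates every unit modulo \<open>n\<close>,
  so it is a multiple of each order, hence of Carmichael's function and of
  \<open>lcm_pred_primes n\<close>.\<close>

lemma
  assumes n: "n > 1"
  shows totient_eq_fermat_index: "totient n = fermat_index n * card (fermat_bases n)"
    and lcm_pred_primes_dvd_fermat_index: "lcm_pred_primes n dvd fermat_index n * (n - 1)"
    and fermat_index_pos: "fermat_index n > 0"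
proof -
  obtain K where K: "totient n = K * card (fermat_bases n)"
    "\<And>a. coprime a n \<Longrightarrow> [a ^ (K * (n - 1)) = 1] (mod n)"
    using fermat_bases_index[OF n] by blast
  have "card (fermat_bases n) > 0" using n by (simp add: card_fermat_bases_pos)
  with K(1) have eq: "fermat_index n = K" by (simp add: fermat_index_def)
  thus "totient n = fermat_index n * card (fermat_bases n)" using K(1) by simp
  show "fermat_index n > 0" using K(1) n eq by (metis gr0I mult_0 totient_gt_0_iff not_one_less_zero zero_less_one less_trans less_irrefl)
  have "Carmichael n dvd K * (n - 1)"
    unfolding Carmichael_def
  proof (rule Lcm_least, safe)
    fix a assume "a \<in> totatives n"
    hence "[a ^ (K * (n - 1)) = 1] (mod n)" using K(2) by (simp add: totatives_def)
    thus "ord n a dvd K * (n - 1)" by (simp only: ord_divides)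
  qed
  thus "lcm_pred_primes n dvd fermat_index n * (n - 1)"
    using lcm_pred_primes_dvd_Carmichael[of n] n eq by (metis dvd_trans gr_implies_not0 neq0_conv)
qed

text \<open>The cofactor \<open>k\<close> of the gcd in \<open>a\<close> is coprime to the cofactor
  of the gcd in \<open>n - 1\<close>; as \<open>a\<close> divides
  \<open>fermat_index n * (n - 1)\<close>, it follows that \<open>k\<close> divides the index. This
  yields congruences n \<equiv> 1 modulo a / k with small \<open>k\<close>.\<close>

lemma obtain_index_factor:
  assumes n: "n > 1" and a: "a dvd lcm_pred_primes n" "a > 0"
  obtains k where "k > 0" "a = k * gcd a (n - 1)" "k \<le> fermat_index n"
proof -
  define k where "k = a div gcd a (n - 1)"
  have ak: "a = k * gcd a (n - 1)" by (simp add: k_def)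
  have "k * gcd a (n - 1) dvd fermat_index n * (n - 1)"
    using a lcm_pred_primes_dvd_fermat_index[OF n] ak by (metis dvd_trans)
  moreover have "fermat_index n * (n - 1) = gcd a (n - 1) * (fermat_index n * ((n - 1) div gcd a (n - 1)))"
    by simp
  ultimately have "gcd a (n - 1) * k dvd gcd a (n - 1) * (fermat_index n * ((n - 1) div gcd a (n - 1)))"
    by (simp only: mult.commute[of k])
  moreover have "gcd a (n - 1) > 0" using a by simp
  ultimately have "k dvd fermat_index n * ((n - 1) div gcd a (n - 1))"
    by (rule dvd_mult_cancel)
  moreover have "coprime k ((n - 1) div gcd a (n - 1))"
    unfolding k_def using a by (intro div_gcd_coprime) auto
  ultimately have "k dvd fermat_index n" by (simp add: coprime_dvd_mult_left_iff)
  hence "k \<le> fermat_index n" using fermat_index_pos[OF n] by (intro dvd_imp_le)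
  moreover have "k > 0" using a ak by (metis gr0I mult_0)
  ultimately show ?thesis using ak that by blast
qed

section \<open>Counting integers in residue classes\<close>

lemma card_cong_le:
  assumes "q > 0" "\<And>a. a \<in> A \<Longrightarrow> real a < x" "\<And>a b. a \<in> A \<Longrightarrow> b \<in> A \<Longrightarrow> [a = b] (mod q)"
    and x: "x \<ge> 0"
  shows "real (card A) \<le> 1 + x / real q"
proof -
  have "card A \<le> card {0..nat \<lfloor>x / real q\<rfloor>}"
  proof (rule card_inj_on_le)
    show "inj_on (\<lambda>a. a div q) A"
    proof (rule inj_onI)
      fix a b assume "a \<in> A" "b \<in> A" "a div q = b div q"
      moreover from this have "a mod q = b mod q" using assms(3)[of a b] unfolding unique_euclidean_semiring_class.cong_def by blast
      ultimately show "a = b" by (metis div_mult_mod_eq)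
    qed
    show "(\<lambda>a. a div q) ` A \<subseteq> {0..nat \<lfloor>x / real q\<rfloor>}"
    proof safe
      fix a assume a: "a \<in> A"
      have "real (a div q) \<le> real a / real q" by (metis floor_divide_of_nat_eq of_int_floor_le of_int_of_nat_eq)
      also have "\<dots> \<le> x / real q" using assms(1,2) a by (intro divide_right_mono) (auto intro: less_imp_le)
      finally show "a div q \<in> {0..nat \<lfloor>x / real q\<rfloor>}" by (simp add: le_nat_floor)
    qed
  qed simp
  hence "real (card A) \<le> 1 + real (nat \<lfloor>x / real q\<rfloor>)" by simp
  also have "real (nat \<lfloor>x / real q\<rfloor>) \<le> x / real q" using x by (simp add: of_nat_nat)
  finally show ?thesis by simp
qed

text \<open>A single element \<open>n\<close> of \<open>A\<close> shows that \<open>d\<close> and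
  \<open>t\<close> are coprime, since \<open>d dvd n\<close> and \<open>t dvd n - 1\<close>. The
  Chinese remainder theorem then puts \<open>A\<close> into one residue class modulo
  \<open>d * t\<close>.\<close>

lemma card_multiples_cong_1_le:
  assumes "d > 0" "t > 0" "x \<ge> 0"
    and A: "\<And>n. n \<in> A \<Longrightarrow> n > 0 \<and> real n < x \<and> d dvd n \<and> t dvd n - 1"
  shows "real (card A) \<le> 1 + x / (real d * real t)"
proof (cases "A = {}")
  case False
  then obtain n where n: "n \<in> A" by auto
  have "coprime (n - 1) n" using A[OF n] by (metis coprime_diff_one_left_nat)
  hence "coprime d t" using A[OF n] coprime_divisors[of t "n - 1" d n] by (simp add: ac_simps)
  have "real (card A) \<le> 1 + x / real (d * t)"
  proof (rule card_cong_le)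
    fix a b assume ab: "a \<in> A" "b \<in> A"
    have "[a = b] (mod d)" using A ab by (metis cong_0_iff cong_sym cong_trans)
    moreover have "[a - 1 + 1 = b - 1 + 1] (mod t)"
      using A ab by (intro cong_add) (metis cong_0_iff cong_sym cong_trans, simp)
    hence "[a = b] (mod t)" using A[OF ab(1)] A[OF ab(2)] by simp
    ultimately show "[a = b] (mod d * t)" using \<open>coprime d t\<close> by (simp add: coprime_cong_mult_nat)
  qed (use assms A in auto)
  thus ?thesis by simp
qed (use assms in simp)

text \<open>Writing n = p m, the condition \<open>t dvd p - 1\<close> gives m \<equiv> 1 modulo
  \<open>t\<close>, so m = 1 + t j, and \<open>n > p\<close> excludes j = 0. This avoids the
  additive 1 of the previous count, which would be too large when summed over all \<open>p\<close>
  up to \<open>x\<close>.\<close>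

lemma card_composite_multiples_le:
  assumes p: "p > 1" and t: "t > 0" "t dvd p - 1" and x: "x \<ge> 0"
    and A: "\<And>n. n \<in> A \<Longrightarrow> n > p \<and> real n < x \<and> p dvd n \<and> t dvd n - 1"
  shows "real (card A) \<le> x / (real p * real t)"
proof -
  have mod: "\<exists>j. n = p * (1 + t * j) \<and> j > 0" if n: "n \<in> A" for n
  proof -
    obtain m where m: "n = p * m" using A[OF n] by auto
    with A[OF n] have m1: "m > 1" by (cases "m = 1") (auto intro!: Nat.gr0I simp: nat_neq_iff)
    have "n - 1 = (p - 1) * m + (m - 1)" using m1 p m by (simp add: algebra_simps diff_mult_distrib)
    with A[OF n] t have "t dvd m - 1" by (metis dvd_add_right_iff dvd_mult2)
    then obtain j where "m - 1 = t * j" by auto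
    moreover from this have "j > 0" using m1 by (auto intro!: Nat.gr0I)
    moreover have "m = 1 + t * j" using \<open>m - 1 = t * j\<close> m1 by linarith
    ultimately show ?thesis using m by blast
  qed
  have "card A \<le> card {1..nat \<lfloor>x / (real p * real t)\<rfloor>}"
  proof (rule card_inj_on_le)
    let ?f = "\<lambda>n. (n div p - 1) div t"
    show "inj_on ?f A"
    proof (rule inj_onI)
      fix a b assume ab: "a \<in> A" "b \<in> A" and eq: "?f a = ?f b"
      obtain i j where "a = p * (1 + t * i)" "b = p * (1 + t * j)" using mod ab by meson
      with eq p t show "a = b" by simp
    qed
    show "?f ` A \<subseteq> {1..nat \<lfloor>x / (real p * real t)\<rfloor>}"
    proof safe
      fix a assume a: "a \<in> A"
      then obtain j where j: "a = p * (1 + t * j)" "j > 0" using mod by blast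
      have "real (p * t * j) \<le> real a" by (intro of_nat_mono) (simp add: j algebra_simps)
      also have "\<dots> \<le> x" using A[OF a] by simp
      finally have "real j \<le> x / (real p * real t)" using p t by (simp add: field_simps)
      thus "?f a \<in> {1..nat \<lfloor>x / (real p * real t)\<rfloor>}" using j p t by (simp add: le_nat_floor)
    qed
  qed simp
  hence "real (card A) \<le> real (nat \<lfloor>x / (real p * real t)\<rfloor>)" by simp
  also have "\<dots> \<le> x / (real p * real t)" using x by (simp add: of_nat_nat)
  finally show ?thesis .
qed

subsection \<open>Summation over composite numbers\<close>

lemma sum_inverse_consecutive_le:
  fixes m N :: nat
  assumes "m > 0"
  shows "(\<Sum>p\<in>{m<..N}. 1 / (real p * (real p - 1))) \<le> 1 / real m"
proof -
  have "(\<Sum>p\<in>{m<..N}. 1 / (real p * (real p - 1))) \<le> 1 / real m - 1 / real (max m N)"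
  proof (induction N)
    case (Suc N)
    show ?case
    proof (cases "m \<le> N")
      case True
      hence "{m<..Suc N} = insert (Suc N) {m<..N}" by auto
      moreover have "1 / (real (Suc N) * (real (Suc N) - 1)) = 1 / real N - 1 / real (Suc N)"
        using True assms by (simp add: field_simps)
      ultimately show ?thesis using Suc True by (simp add: max_def)
    next
      case False
      hence "{m<..Suc N} = {}" "max m (Suc N) = m" by auto
      thus ?thesis by simp
    qed
  qed simp
  also have "\<dots> \<le> 1 / real m" by simp
  finally show ?thesis .
qed

text \<open>The largest divisor \<open>d\<close> of \<open>n\<close> that is at most
  \<open>z\<close> works: since \<open>n > z\<close>, its cofactor has a prime factor
  \<open>p \<le> y\<close>, and by maximality \<open>d * p\<close> exceeds \<open>z\<close>.\<close>

lemma exists_divisor_between: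
  fixes n :: nat and y z :: real
  assumes "n > 0" "1 \<le> z" "z < real n" "\<And>p. prime p \<Longrightarrow> p dvd n \<Longrightarrow> real p \<le> y"
  obtains d where "d dvd n" "real d \<le> z" "z < real d * y"
proof -
  define D where "D = {d. d dvd n \<and> real d \<le> z}"
  have "finite D" using assms(1) unfolding D_def by (intro finite_subset[OF _ finite_divisors_nat]) auto
  moreover have "1 \<in> D" using assms by (auto simp: D_def)
  ultimately have Max: "Max D \<in> D" "\<And>d. d \<in> D \<Longrightarrow> d \<le> Max D" by (auto intro: Max_in)
  define d where "d = Max D"
  have d: "d dvd n" "real d \<le> z" using Max(1) by (auto simp: D_def d_def)
  then obtain m where m: "n = d * m" by auto
  hence "m \<noteq> 1" using d assms by auto
  then obtain p where p: "prime p" "p dvd m" by (metis prime_factor_nat)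
  have "d > 0" using assms m by (auto intro: Nat.gr0I)
  have "d * p dvd n" using m p by simp
  moreover have "d < d * p" using prime_gt_1_nat[OF p(1)] \<open>d > 0\<close> by simp
  ultimately have "\<not> real (d * p) \<le> z" using Max(2)[of "d * p"] by (auto simp: D_def d_def)
  hence "z < real d * real p" by simp
  also have "\<dots> \<le> real d * y" using assms(4)[OF p(1)] p m by (intro mult_left_mono) auto
  finally show ?thesis using d that by blast
qed

text \<open>The condition is put on the number of bases, so that each composite outside contributes
  at most \<open>x / \<Lambda>\<close>; inside, \<open>fermat_index_less\<close> bounds the index by
  \<open>\<Lambda>\<close>.\<close>

definition low_fermat_index :: "real \<Rightarrow> real \<Rightarrow> nat set" where
  "low_fermat_index x \<Lambda> = {n. n > 1 \<and> \<not> prime n \<and> real n < x \<and> x / \<Lambda> < real (card (fermat_bases n))}"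

lemma finite_low_fermat_index [simp]: "finite (low_fermat_index x \<Lambda>)"
  by (rule finite_subset[of _ "{..nat \<lceil>x\<rceil>}"]) (auto simp: low_fermat_index_def, linarith)

lemma fermat_index_less:
  assumes "n \<in> low_fermat_index x \<Lambda>" "x > 0" "\<Lambda> > 0"
  shows "real (fermat_index n) < \<Lambda>"
proof -
  have n: "n > 1" "real n < x" "x / \<Lambda> < real (card (fermat_bases n))"
    using assms by (auto simp: low_fermat_index_def)
  have "real (fermat_index n) * (x / \<Lambda>) < real (fermat_index n) * real (card (fermat_bases n))"
    using n fermat_index_pos[OF n(1)] by (intro mult_strict_left_mono) auto
  also have "\<dots> = real (totient n)" using totient_eq_fermat_index[OF n(1)] by simp
  also have "\<dots> < x" using totient_le[of n] n by linarith
  finally show ?thesis using assms by (simp add: field_simps)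
qed

text \<open>For a prime factor \<open>p > \<Lambda>\<^sup>2\<close> of \<open>n\<close>, write
  \<open>p - 1 = k * t\<close> with \<open>t dvd n - 1\<close> and \<open>k < \<Lambda>\<close>. The
  weight is at most \<open>1 / k\<close> and the count at most \<open>x / (p * t)\<close>, so
  \<open>k\<close> cancels: each pair contributes at most \<open>x / (p * (p - 1))\<close>, for at
  most \<open>\<Lambda>\<close> values of \<open>k\<close>.\<close>

lemma sum_index_large_prime:
  assumes x: "x > 0" and \<Lambda>: "\<Lambda> \<ge> 1"
  shows "(\<Sum>n | n \<in> low_fermat_index x \<Lambda> \<and> (\<exists>p. prime p \<and> p dvd n \<and> \<Lambda>\<^sup>2 < real p).
            1 / real (fermat_index n)) \<le> 2 * x / \<Lambda>"
    (is "sum ?g ?B \<le> _")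
proof -
  define m where "m = nat \<lfloor>\<Lambda>\<^sup>2\<rfloor>"
  have \<Lambda>2: "\<Lambda>\<^sup>2 \<ge> 1" using \<Lambda> by simp
  hence m: "m > 0" "real m \<le> \<Lambda>\<^sup>2" "\<Lambda>\<^sup>2 < real m + 1" by (simp_all add: m_def)
  define I where "I = {m<..nat \<lceil>x\<rceil>} \<times> {1..nat \<lfloor>\<Lambda>\<rfloor>}"
  define S where "S = (\<lambda>(p, k). {n \<in> low_fermat_index x \<Lambda>. prime p \<and> p dvd n \<and>
      p - 1 = k * gcd (p - 1) (n - 1) \<and> k \<le> fermat_index n})"
  have "sum ?g ?B \<le> (\<Sum>i\<in>I. sum ?g (S i))"
  proof (rule sum_le_sum_cover)
    show "?B \<subseteq> (\<Union>i\<in>I. S i)"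
    proof
      fix n assume "n \<in> ?B"
      then obtain p where n: "n \<in> low_fermat_index x \<Lambda>" and p: "prime p" "p dvd n" "\<Lambda>\<^sup>2 < real p"
        by auto
      have n1: "n > 1" "real n < x" using n by (auto simp: low_fermat_index_def)
      obtain k where k: "k > 0" "p - 1 = k * gcd (p - 1) (n - 1)" "k \<le> fermat_index n"
        using obtain_index_factor[OF n1(1) prime_minus_1_dvd_lcm_pred_primes[OF p(1,2)]] n1 prime_gt_1_nat[OF p(1)]
        by (metis gr_implies_not0 neq0_conv zero_less_diff)
      have "k \<le> nat \<lfloor>\<Lambda>\<rfloor>" using k(3) fermat_index_less[OF n x] \<Lambda> by (intro le_nat_floor) linarith
      moreover have "p \<le> n" using p n1 by (intro dvd_imp_le) auto
      hence "p \<le> nat \<lceil>x\<rceil>" using n1 by linarith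
      moreover have "m < p" using p(3) m(2) by linarith
      ultimately have "(p, k) \<in> I" using k(1) by (auto simp: I_def)
      moreover have "n \<in> S (p, k)" using n p k by (auto simp: S_def)
      ultimately show "n \<in> (\<Union>i\<in>I. S i)" by blast
    qed
  qed (auto simp: I_def S_def)
  also have "\<dots> \<le> (\<Sum>(p, k)\<in>I. x / (real p * (real p - 1)))"
  proof (rule sum_mono, clarify)
    fix p k assume pk: "(p, k) \<in> I"
    hence k: "k > 0" by (auto simp: I_def)
    have p1: "p > 1" using pk m by (auto simp: I_def)
    show "sum ?g (S (p, k)) \<le> x / (real p * (real p - 1))"
    proof (cases "S (p, k) = {}")
      case False
      then obtain t where t: "p - 1 = k * t" by (auto simp: S_def)
      have t0: "t > 0" using t p1 by (auto intro!: Nat.gr0I)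
      have "sum ?g (S (p, k)) \<le> (\<Sum>n\<in>S (p, k). 1 / real k)"
        using k by (intro sum_mono divide_left_mono mult_pos_pos) (auto simp: S_def)
      also have "\<dots> = real (card (S (p, k))) / real k" by simp
      also have "\<dots> \<le> (x / (real p * real t)) / real k"
      proof (rule divide_right_mono[OF card_composite_multiples_le])
        fix n assume n: "n \<in> S (p, k)"
        hence *: "p dvd n" "n > 1" "real n < x" "\<not> prime n" "prime p"
          "p - 1 = k * gcd (p - 1) (n - 1)"
          by (auto simp: S_def low_fermat_index_def)
        \<comment> \<open>Compositeness enters here: it rules out \<open>n = p\<close>.\<close>
        have "p \<noteq> n" using * by auto
        hence "p < n" using dvd_imp_le[OF *(1)] * by linarith
        moreover have "t = gcd (p - 1) (n - 1)" using *(6) t k by (metis mult_cancel1 neq0_conv)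
        ultimately show "p < n \<and> real n < x \<and> p dvd n \<and> t dvd n - 1" using * by simp
      qed (use p1 t t0 x in auto)
      also have "\<dots> = x / (real p * (real k * real t))" by (simp add: field_simps)
      also have "real k * real t = real p - 1" using t p1 by (metis of_nat_mult of_nat_diff of_nat_1 less_imp_le_nat)
      finally show ?thesis .
    qed (use p1 x in simp)
  qed
  also have "\<dots> = real (nat \<lfloor>\<Lambda>\<rfloor>) * x * (\<Sum>p\<in>{m<..nat \<lceil>x\<rceil>}. 1 / (real p * (real p - 1)))"
    by (simp add: I_def flip: sum.cartesian_product) (simp add: sum_distrib_left)
  also have "\<dots> \<le> \<Lambda> * x * (2 / \<Lambda>\<^sup>2)"
  proof (rule mult_mono)
    have "(\<Sum>p\<in>{m<..nat \<lceil>x\<rceil>}. 1 / (real p * (real p - 1))) \<le> 1 / real m"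
      by (rule sum_inverse_consecutive_le[OF m(1)])
    \<comment> \<open>Rounding \<open>\<Lambda>\<^sup>2\<close> down to \<open>m \<ge> 1\<close>
      loses at most the factor 2.\<close>
    also have "\<dots> \<le> 2 / \<Lambda>\<^sup>2"
    proof -
      have "0 < real m" "\<Lambda>\<^sup>2 \<le> 2 * real m" using m by linarith+
      moreover have "1 / real m = 2 / (2 * real m)" by simp
      moreover have "0 < 2 * real m * \<Lambda>\<^sup>2"
        using \<Lambda>2 \<open>0 < real m\<close> by (intro mult_pos_pos) linarith+
      ultimately show ?thesis
        using divide_left_mono[of "\<Lambda>\<^sup>2" "2 * real m" 2] by linarith
    qed
    finally show "(\<Sum>p\<in>{m<..nat \<lceil>x\<rceil>}. 1 / (real p * (real p - 1))) \<le> 2 / \<Lambda>\<^sup>2" .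
  next
    show "0 \<le> (\<Sum>p\<in>{m<..nat \<lceil>x\<rceil>}. 1 / (real p * (real p - 1)))"
      using m by (intro sum_nonneg) auto
  qed (use x \<Lambda> in \<open>auto intro: mult_right_mono\<close>)
  also have "\<dots> = 2 * x / \<Lambda>" using \<Lambda> by (simp add: power2_eq_square)
  finally show ?thesis .
qed

text \<open>Every such \<open>n\<close> has a divisor \<open>d\<close> in
  \<open>(x / \<Lambda> ^ 3, x / \<Lambda>]\<close>. With \<open>lcm_pred_primes d = k * t\<close>
  and \<open>t dvd n - 1\<close>, the count is at most \<open>1 + x / (d * t)\<close> and the weight
  at most \<open>1 / k\<close>. The 1 costs the number of \<open>d\<close> times a harmonic sum; the
  rest is \<open>x / (d * lcm_pred_primes d)\<close>, controlled by the fibre bound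
  \<open>T\<close>.\<close>

lemma sum_index_smooth:
  assumes x: "x \<ge> 1" and \<Lambda>: "\<Lambda> \<ge> 1" "\<Lambda> ^ 3 \<le> x" and c: "c \<le> 1"
    and T: "\<And>m. m > 0 \<Longrightarrow> (\<Sum>d | d > 0 \<and> real d \<le> x \<and> lcm_pred_primes d = m. real d powr -c) \<le> T"
  shows "(\<Sum>n | n \<in> low_fermat_index x \<Lambda> \<and> \<not> (\<exists>p. prime p \<and> p dvd n \<and> \<Lambda>\<^sup>2 < real p).
            1 / real (fermat_index n))
         \<le> x / \<Lambda> * (1 + ln x) + x * ((1 + ln x)\<^sup>2 * (T * (x / \<Lambda> ^ 3) powr (c - 1)))"
    (is "sum ?g ?C \<le> _")
proof -
  define N where "N = nat \<lfloor>x\<rfloor>"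
  have leN: "n \<le> N \<longleftrightarrow> real n \<le> x" for n using x by (simp add: N_def le_nat_iff le_floor_iff)
  have N: "N \<ge> 1" using x leN[of 1] by simp
  have harm: "(\<Sum>k=1..N. 1 / real k) \<le> 1 + ln x"
  proof -
    have "(\<Sum>k=1..N. 1 / real k) \<le> 1 + ln (real N)" using harmonic_le[of N] N by simp
    also have "\<dots> \<le> 1 + ln x" using leN[of N] N x by simp
    finally show ?thesis .
  qed
  define D where "D = {d. x / \<Lambda> ^ 3 < real d \<and> real d \<le> x / \<Lambda>}"
  have "x / \<Lambda> ^ 3 > 0" using x \<Lambda> by simp
  hence Dpos: "d > 0" if "d \<in> D" for d using that by (auto simp: D_def intro!: Nat.gr0I)
  have "x / \<Lambda> \<le> x / 1" using x \<Lambda> by (intro divide_left_mono) auto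
  hence Dx: "real d \<le> x" if "d \<in> D" for d using that by (auto simp: D_def)
  have D_sub: "D \<subseteq> {1..nat \<lfloor>x / \<Lambda>\<rfloor>}"
    using Dpos by (auto simp: D_def Suc_le_eq intro!: le_nat_floor)
  hence finD: "finite D" by (rule finite_subset) simp
  \<comment> \<open>Divisibility by \<open>k\<close> is recorded so that the cofactor
    \<open>t\<close> can later serve as a summation variable.\<close>
  define I where "I = {(d, k). d \<in> D \<and> k \<in> {1..N} \<and> k dvd lcm_pred_primes d}"
  have I_sub: "I \<subseteq> D \<times> {1..N}" by (auto simp: I_def)
  hence finI: "finite I" by (rule finite_subset) (use finD in auto)
  define S where "S = (\<lambda>(d, k). {n \<in> low_fermat_index x \<Lambda>. d dvd n \<and>
      lcm_pred_primes d = k * gcd (lcm_pred_primes d) (n - 1) \<and> k \<le> fermat_index n})"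
  have "sum ?g ?C \<le> (\<Sum>i\<in>I. sum ?g (S i))"
  proof (rule sum_le_sum_cover)
    show "?C \<subseteq> (\<Union>i\<in>I. S i)"
    proof
      fix n assume nC: "n \<in> ?C"
      hence n: "n \<in> low_fermat_index x \<Lambda>" by blast
      have smooth: "real p \<le> \<Lambda>\<^sup>2" if "prime p" "p dvd n" for p
        using nC that by (simp only: mem_Collect_eq not_le [symmetric]) blast
      have n1: "n > 1" "real n < x" "x / \<Lambda> < real (card (fermat_bases n))"
        using n by (auto simp: low_fermat_index_def)
      have "card (fermat_bases n) \<le> n" using card_fermat_bases_le totient_le le_trans by blast
      hence "x / \<Lambda> < real n" using n1 by linarith
      moreover have "1 \<le> x / \<Lambda>"
      proof -
        have "\<Lambda> ^ 1 \<le> \<Lambda> ^ 3" using \<Lambda> by (intro power_increasing) auto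
        thus ?thesis using \<Lambda> by simp
      qed
      ultimately obtain d where d: "d dvd n" "real d \<le> x / \<Lambda>" "x / \<Lambda> < real d * \<Lambda>\<^sup>2"
        using exists_divisor_between[OF _ _ _ smooth, of n "x / \<Lambda>"] n1(1) by (metis gr_implies_not0 neq0_conv)
      have dD: "d \<in> D" using d \<Lambda> by (simp add: D_def field_simps power3_eq_cube power2_eq_square)
      have psid: "lcm_pred_primes d > 0" using Dpos[OF dD] by (rule lcm_pred_primes_pos)
      obtain k where k: "k > 0" "lcm_pred_primes d = k * gcd (lcm_pred_primes d) (n - 1)" "k \<le> fermat_index n"
        using obtain_index_factor[OF n1(1) lcm_pred_primes_mono[OF d(1)] psid] n1 by (metis gr_implies_not0 neq0_conv)
      have kd: "k dvd lcm_pred_primes d" using k(2) by (metis dvd_triv_left)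
      have "k \<le> lcm_pred_primes d" using kd psid by (rule dvd_imp_le)
      also have "\<dots> \<le> d" using lcm_pred_primes_le Dpos[OF dD] by blast
      finally have "k \<le> N" using Dx[OF dD] by (simp add: leN)
      with k kd dD have "(d, k) \<in> I" by (auto simp: I_def)
      moreover have "n \<in> S (d, k)" using n d k by (auto simp: S_def)
      ultimately show "n \<in> (\<Union>i\<in>I. S i)" by blast
    qed
  qed (use finI in \<open>auto simp: S_def\<close>)
  also have "\<dots> \<le> (\<Sum>(d, k)\<in>I. 1 / real k + x * (1 / (real d * real (lcm_pred_primes d))))"
  proof (rule sum_mono, clarify)
    fix d k assume dk: "(d, k) \<in> I"
    hence k: "k > 0" and d: "d > 0" and "k dvd lcm_pred_primes d" using Dpos by (auto simp: I_def)
    then obtain t where t: "lcm_pred_primes d = k * t" by auto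
    have t0: "t > 0" using lcm_pred_primes_pos[OF d] t by (auto intro: Nat.gr0I)
    have "sum ?g (S (d, k)) \<le> (\<Sum>n\<in>S (d, k). 1 / real k)"
      using k by (intro sum_mono divide_left_mono mult_pos_pos) (auto simp: S_def)
    also have "\<dots> = real (card (S (d, k))) / real k" by simp
    also have "\<dots> \<le> (1 + x / (real d * real t)) / real k"
    proof (rule divide_right_mono[OF card_multiples_cong_1_le])
      fix n assume n: "n \<in> S (d, k)"
      hence "lcm_pred_primes d = k * gcd (lcm_pred_primes d) (n - 1)" by (simp add: S_def)
      hence "t = gcd (lcm_pred_primes d) (n - 1)" using t k by (metis mult_cancel1 neq0_conv)
      hence "t dvd n - 1" by simp
      thus "0 < n \<and> real n < x \<and> d dvd n \<and> t dvd n - 1"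
        using n by (auto simp: S_def low_fermat_index_def)
    qed (use d t0 x in auto)
    also have "\<dots> = 1 / real k + x * (1 / (real d * real (lcm_pred_primes d)))"
      using k t by (simp add: field_simps)
    finally show "sum ?g (S (d, k)) \<le> 1 / real k + x * (1 / (real d * real (lcm_pred_primes d)))" .
  qed
  also have "\<dots> = (\<Sum>(d, k)\<in>I. 1 / real k) + x * (\<Sum>(d, k)\<in>I. 1 / (real d * real (lcm_pred_primes d)))"
    by (simp add: case_prod_unfold sum.distrib sum_distrib_left)
  also have "(\<Sum>(d, k)\<in>I. 1 / real k) \<le> x / \<Lambda> * (1 + ln x)"
  proof -
    have "(\<Sum>(d, k)\<in>I. 1 / real k) \<le> (\<Sum>(d, k)\<in>D \<times> {1..N}. 1 / real k)"
      using I_sub finD by (intro sum_mono2) auto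
    also have "\<dots> = real (card D) * (\<Sum>k=1..N. 1 / real k)"
      by (simp flip: sum.cartesian_product)
    also have "\<dots> \<le> x / \<Lambda> * (1 + ln x)"
    proof (rule mult_mono[OF _ harm])
      have "card D \<le> nat \<lfloor>x / \<Lambda>\<rfloor>" using card_mono[OF _ D_sub] by simp
      thus "real (card D) \<le> x / \<Lambda>" using x \<Lambda> by (simp add: le_nat_floor le_nat_iff le_floor_iff)
    qed (use x \<Lambda> in \<open>auto intro: sum_nonneg\<close>)
    finally show ?thesis .
  qed
  \<comment> \<open>Grouping by \<open>(k, t)\<close> with \<open>lcm_pred_primes d = k * t\<close>
    turns the summand into a product of \<open>1 / k\<close>, \<open>1 / t\<close> and
    \<open>1 / d\<close>, and leaves a sum over one fibre.\<close>
  also have "(\<Sum>(d, k)\<in>I. 1 / (real d * real (lcm_pred_primes d)))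
      \<le> (\<Sum>(k, t)\<in>{1..N} \<times> {1..N}. \<Sum>(d, k)\<in>{d \<in> D. lcm_pred_primes d = k * t} \<times> {k}. 1 / (real d * real (lcm_pred_primes d)))"
  proof -
    let ?U = "\<lambda>(k, t). {d \<in> D. lcm_pred_primes d = k * t} \<times> {k}"
    have "(\<Sum>(d, k)\<in>I. 1 / (real d * real (lcm_pred_primes d)))
      \<le> (\<Sum>i\<in>{1..N} \<times> {1..N}. \<Sum>(d, k)\<in>?U i. 1 / (real d * real (lcm_pred_primes d)))"
    proof (rule sum_le_sum_cover)
      show "I \<subseteq> (\<Union>i\<in>{1..N} \<times> {1..N}. ?U i)"
      proof clarify
        fix d k assume dk: "(d, k) \<in> I"
        then obtain t where t: "lcm_pred_primes d = k * t" by (auto simp: I_def)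
        have d: "d \<in> D" "k \<in> {1..N}" using dk by (auto simp: I_def)
        have "lcm_pred_primes d > 0" using Dpos[OF d(1)] by (rule lcm_pred_primes_pos)
        hence t': "t > 0" using t by (auto intro: Nat.gr0I)
        have "t \<le> lcm_pred_primes d" using t d by simp
        also have "lcm_pred_primes d \<le> d" by (rule lcm_pred_primes_le) (use Dpos d in auto)
        also have "d \<le> N" using Dx[OF d(1)] leN by simp
        finally have "t \<le> N" .
        hence "(k, t) \<in> {1..N} \<times> {1..N}" "(d, k) \<in> ?U (k, t)" using d t t' by auto
        thus "(d, k) \<in> (\<Union>i\<in>{1..N} \<times> {1..N}. ?U i)" by blast
      qed
    qed (use finD in auto)
    thus ?thesis by (simp add: case_prod_unfold)
  qed
  also have "\<dots> \<le> (\<Sum>(k, t)\<in>{1..N} \<times> {1..N}. 1 / real k * (1 / real t) * (T * (x / \<Lambda> ^ 3) powr (c - 1)))"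
  proof (rule sum_mono, clarify)
    fix k t assume kt: "k \<in> {1..N}" "t \<in> {1..N}"
    have "(\<Sum>(d, k)\<in>{d \<in> D. lcm_pred_primes d = k * t} \<times> {k}. 1 / (real d * real (lcm_pred_primes d)))
        = (\<Sum>d | d \<in> D \<and> lcm_pred_primes d = k * t. 1 / real k * (1 / real t) * (1 / real d))"
      by (simp flip: sum.cartesian_product) (auto intro!: sum.cong simp: field_simps)
    also have "\<dots> = 1 / real k * (1 / real t) * (\<Sum>d | d \<in> D \<and> lcm_pred_primes d = k * t. 1 / real d)"
      by (simp add: sum_distrib_left)
    \<comment> \<open>Rankin's trick: \<open>1 / d\<close> is
      \<open>d powr -c * d powr (c - 1)\<close>, and the second factor is at most its value at the
      lower end of \<open>D\<close> because \<open>c \<le> 1\<close>.\<close>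
    also have "(\<Sum>d | d \<in> D \<and> lcm_pred_primes d = k * t. 1 / real d)
        \<le> (\<Sum>d | d \<in> D \<and> lcm_pred_primes d = k * t. real d powr -c * (x / \<Lambda> ^ 3) powr (c - 1))"
    proof (rule sum_mono, clarify)
      fix d assume d: "d \<in> D"
      have "1 / real d = real d powr -1" using Dpos[OF d] by (simp add: powr_minus divide_inverse)
      also have "\<dots> = real d powr -c * real d powr (c - 1)" by (simp flip: powr_add)
      also have "real d powr (c - 1) \<le> (x / \<Lambda> ^ 3) powr (c - 1)"
        using d c x \<Lambda> by (intro powr_mono2') (auto simp: D_def)
      finally show "1 / real d \<le> real d powr -c * (x / \<Lambda> ^ 3) powr (c - 1)" by (simp add: mult_left_mono)
    qed
    also have "\<dots> = (\<Sum>d | d \<in> D \<and> lcm_pred_primes d = k * t. real d powr -c) * (x / \<Lambda> ^ 3) powr (c - 1)"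
      by (simp add: sum_distrib_right)
    also have "(\<Sum>d | d \<in> D \<and> lcm_pred_primes d = k * t. real d powr -c)
        \<le> (\<Sum>d | d > 0 \<and> real d \<le> x \<and> lcm_pred_primes d = k * t. real d powr -c)"
    proof (rule sum_mono2)
      show "finite {d. d > 0 \<and> real d \<le> x \<and> lcm_pred_primes d = k * t}"
        by (rule finite_subset[of _ "{..N}"]) (auto simp: leN)
    qed (use Dx Dpos in auto)
    also have "\<dots> \<le> T" using kt by (intro T) auto
    finally show "(\<Sum>(d, k)\<in>{d \<in> D. lcm_pred_primes d = k * t} \<times> {k}. 1 / (real d * real (lcm_pred_primes d)))
        \<le> 1 / real k * (1 / real t) * (T * (x / \<Lambda> ^ 3) powr (c - 1))"
      by (simp add: mult_left_mono mult_right_mono divide_right_mono)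
  qed
  also have "\<dots> = (\<Sum>k=1..N. 1 / real k)\<^sup>2 * (T * (x / \<Lambda> ^ 3) powr (c - 1))"
    unfolding power2_eq_square sum_product sum.cartesian_product
    by (simp only: sum_distrib_right case_prod_unfold)
  also have "\<dots> \<le> (1 + ln x)\<^sup>2 * (T * (x / \<Lambda> ^ 3) powr (c - 1))"
  proof (intro mult_right_mono power_mono harm)
    \<comment> \<open>Nonnegativity of \<open>T\<close> is read off from the fibre over 1.\<close>
    have "0 \<le> (\<Sum>d | d > 0 \<and> real d \<le> x \<and> lcm_pred_primes d = 1. real d powr -c)" by (intro sum_nonneg) auto
    also have "\<dots> \<le> T" by (rule T) simp
    finally show "0 \<le> T * (x / \<Lambda> ^ 3) powr (c - 1)" by simp
  qed (auto intro: sum_nonneg)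
  finally show ?thesis using x by (simp add: mult_left_mono)
qed

text \<open>Composites outside \<open>low_fermat_index\<close> contribute at most
  \<open>x * (x / \<Lambda>)\<close> in all. For the others the number of bases is at most
  \<open>x / fermat_index n\<close>, and the two preceding lemmas apply. In \<open>4 + ln x\<close>,
  1 comes from the first kind, 2 from the large primes and \<open>1 + ln x\<close> from the smooth
  integers.\<close>

lemma sum_card_fermat_bases_le:
  assumes x: "x \<ge> 1" and \<Lambda>: "\<Lambda> \<ge> 1" "\<Lambda> ^ 3 \<le> x" and c: "c \<le> 1"
    and T: "\<And>m. m > 0 \<Longrightarrow> (\<Sum>d | d > 0 \<and> real d \<le> x \<and> lcm_pred_primes d = m. real d powr -c) \<le> T"
  shows "(\<Sum>n | n > 1 \<and> \<not> prime n \<and> real n < x. real (card (fermat_bases n)))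
         \<le> x\<^sup>2 * ((4 + ln x) / \<Lambda> + (1 + ln x)\<^sup>2 * (T * (x / \<Lambda> ^ 3) powr (c - 1)))"
proof -
  let ?N = "{n. n > 1 \<and> \<not> prime n \<and> real n < x}"
  let ?F = "\<lambda>n. real (card (fermat_bases n))"
  let ?G = "low_fermat_index x \<Lambda>"
  let ?P = "\<lambda>n. \<exists>p. prime p \<and> p dvd n \<and> \<Lambda>\<^sup>2 < real p"
  have finN: "finite ?N" by (rule finite_subset[of _ "{..nat \<lceil>x\<rceil>}"]) (auto, linarith)
  have cardN: "real (card ?N) \<le> x"
  proof -
    have "?N \<subseteq> {1..nat \<lfloor>x\<rfloor>}" by (auto intro!: le_nat_floor)
    hence "card ?N \<le> nat \<lfloor>x\<rfloor>" using card_mono[of "{1..nat \<lfloor>x\<rfloor>}" ?N] by simp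
    thus ?thesis using x by linarith
  qed
  have G_sub: "?G \<subseteq> ?N" by (auto simp: low_fermat_index_def)
  have "sum ?F ?N = sum ?F ?G + sum ?F (?N - ?G)"
    using sum.subset_diff[OF G_sub finN, of ?F] by simp
  also have "sum ?F (?N - ?G) \<le> (\<Sum>n\<in>?N - ?G. x / \<Lambda>)"
    by (intro sum_mono) (auto simp: low_fermat_index_def)
  also have "\<dots> \<le> (\<Sum>n\<in>?N. x / \<Lambda>)" using finN x \<Lambda> by (intro sum_mono2) auto
  also have "\<dots> = real (card ?N) * (x / \<Lambda>)" by simp
  also have "\<dots> \<le> x * (x / \<Lambda>)" using x \<Lambda> cardN by (intro mult_right_mono) auto
  also have "sum ?F ?G \<le> (\<Sum>n\<in>?G. x * (1 / real (fermat_index n)))"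
  proof (rule sum_mono)
    fix n assume "n \<in> ?G"
    hence n: "n > 1" "real n < x" by (auto simp: low_fermat_index_def)
    have "real (fermat_index n) * ?F n = real (totient n)"
      using totient_eq_fermat_index[OF n(1)] by simp
    also have "\<dots> \<le> x" using totient_le[of n] n by linarith
    finally show "?F n \<le> x * (1 / real (fermat_index n))"
      using fermat_index_pos[OF n(1)] by (simp add: field_simps)
  qed
  also have "\<dots> = x * (\<Sum>n\<in>?G. 1 / real (fermat_index n))" by (simp add: sum_distrib_left)
  also have "(\<Sum>n\<in>?G. 1 / real (fermat_index n))
     = (\<Sum>n | n \<in> ?G \<and> ?P n. 1 / real (fermat_index n)) + (\<Sum>n | n \<in> ?G \<and> \<not> ?P n. 1 / real (fermat_index n))"
    by (subst sum.union_disjoint [symmetric]) (auto intro!: sum.cong)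
  also have "\<dots> \<le> 2 * x / \<Lambda> + (x / \<Lambda> * (1 + ln x) + x * ((1 + ln x)\<^sup>2 * (T * (x / \<Lambda> ^ 3) powr (c - 1))))"
    using assms by (intro add_mono sum_index_large_prime sum_index_smooth) auto
  finally have "sum ?F ?N \<le> x * (2 * x / \<Lambda> + (x / \<Lambda> * (1 + ln x) + x * ((1 + ln x)\<^sup>2 * (T * (x / \<Lambda> ^ 3) powr (c - 1))))) + x * (x / \<Lambda>)"
    using x by (simp add: mult_left_mono)
  also have "\<dots> = x\<^sup>2 * ((4 + ln x) / \<Lambda> + (1 + ln x)\<^sup>2 * (T * (x / \<Lambda> ^ 3) powr (c - 1)))"
    by (simp add: power2_eq_square algebra_simps add_divide_distrib)
  finally show ?thesis .
qed

subsection \<open>Asymptotics\<close>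

lemma card_prime_factors_le_log:
  assumes "m > 0"
  shows "real (card (prime_factors m)) \<le> log 2 (real m)"
proof -
  have "2 ^ card (prime_factors m) \<le> \<Prod>(prime_factors m)"
    using prod_mono[of "prime_factors m" "\<lambda>_. 2::nat" "\<lambda>p. p"] by (auto dest: prime_ge_2_nat in_prime_factors_imp_prime)
  also have "\<dots> \<le> m"
    using assms by (intro dvd_imp_le prod_distinct_primes_dvd) auto
  finally have "real (2 ^ card (prime_factors m)) \<le> real m" by (rule of_nat_mono)
  hence "2 powr real (card (prime_factors m)) \<le> real m" by (simp add: powr_realpow)
  thus ?thesis using assms by (simp add: le_log_iff)
qed

lemma sum_inverse_primes_le_ln_log:
  fixes y :: real
  assumes "y \<ge> 2"
  shows "(\<Sum>p | prime p \<and> real p \<le> y. 1 / real p) \<le> 3 + 2 * ln (log 2 y)"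
proof -
  define K where "K = nat \<lfloor>log 2 y\<rfloor>"
  have log1: "log 2 y \<ge> 1" using assms by (simp add: le_log_iff)
  hence K: "K \<ge> 1" "real K \<le> log 2 y" "log 2 y < real K + 1" unfolding K_def by linarith+
  have "y = 2 powr log 2 y" using assms by simp
  also have "\<dots> \<le> 2 powr real (Suc K)" using K(3) by (intro powr_mono) auto
  finally have "y \<le> 2 powr real (Suc K)" .
  hence y: "y \<le> 2 ^ Suc K" by (subst (asm) powr_realpow) auto
  have "(\<Sum>p | prime p \<and> real p \<le> y. 1 / real p) \<le> (\<Sum>p | prime p \<and> p \<le> 2 ^ Suc K. 1 / real p)"
  proof (rule sum_mono2)
    show "finite {p::nat. prime p \<and> p \<le> 2 ^ Suc K}" by (rule finite_subset[of _ "{..2 ^ Suc K}"]) auto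
    have "p \<le> 2 ^ Suc K" if "real p \<le> y" for p
    proof -
      have "real p \<le> 2 ^ Suc K" using that y by (rule order.trans)
      also have "\<dots> = real (2 ^ Suc K)" by simp
      finally show ?thesis by (simp only: of_nat_le_iff)
    qed
    thus "{p. prime p \<and> real p \<le> y} \<subseteq> {p. prime p \<and> p \<le> 2 ^ Suc K}" by auto
  qed auto
  also have "\<dots> \<le> 1 + 2 * (\<Sum>k=1..K. 1 / real k)" by (rule sum_inverse_primes_le)
  also have "\<dots> \<le> 1 + 2 * (1 + ln (real K))" using harmonic_le[of K] K by (simp add: max_def)
  also have "\<dots> \<le> 3 + 2 * ln (log 2 y)" using K by simp
  finally show ?thesis .
qed

text \<open>Split at \<open>y\<close>. Up to \<open>y\<close>, the term \<open>q powr -c\<close> is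
  at most \<open>y powr (1 - c) / q\<close>, leaving a sum of reciprocals of primes; beyond
  \<open>y\<close>, each term is at most \<open>y powr -c\<close>, and \<open>m\<close> has at most
  \<open>log 2 m\<close> prime factors.\<close>

lemma sum_prime_factors_powr_le:
  fixes y c :: real
  assumes m: "m > 0" and c: "0 \<le> c" "c \<le> 1" and y: "y \<ge> 2"
  shows "(\<Sum>q\<in>prime_factors m. real q powr -c)
    \<le> y powr (1 - c) * (3 + 2 * ln (log 2 y)) + y powr -c * log 2 (real m)"
proof -
  let ?A = "{q \<in> prime_factors m. real q \<le> y}"
  let ?B = "{q \<in> prime_factors m. \<not> real q \<le> y}"
  have "(\<Sum>q\<in>prime_factors m. real q powr -c) = (\<Sum>q\<in>?A \<union> ?B. real q powr -c)"
    by (rule sum.cong) auto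
  also have "\<dots> = (\<Sum>q\<in>?A. real q powr -c) + (\<Sum>q\<in>?B. real q powr -c)"
    by (rule sum.union_disjoint) auto
  also have "(\<Sum>q\<in>?A. real q powr -c) \<le> (\<Sum>q\<in>?A. y powr (1 - c) * (1 / real q))"
  proof (rule sum_mono)
    fix q assume q: "q \<in> ?A"
    hence "q > 0" by (auto intro: prime_gt_0_nat)
    hence "real q powr -c = real q powr (1 - c) * (1 / real q)"
      by (simp add: powr_diff powr_minus divide_inverse)
    also have "\<dots> \<le> y powr (1 - c) * (1 / real q)"
      using q c by (intro mult_right_mono powr_mono2) auto
    finally show "real q powr -c \<le> y powr (1 - c) * (1 / real q)" .
  qed
  also have "\<dots> = y powr (1 - c) * (\<Sum>q\<in>?A. 1 / real q)" by (simp add: sum_distrib_left)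
  also have "(\<Sum>q\<in>?A. 1 / real q) \<le> (\<Sum>p | prime p \<and> real p \<le> y. 1 / real p)"
  proof (rule sum_mono2)
    show "finite {p. prime p \<and> real p \<le> y}"
      by (rule finite_subset[of _ "{..nat \<lfloor>y\<rfloor>}"]) (auto simp: le_nat_floor)
  qed auto
  also have "\<dots> \<le> 3 + 2 * ln (log 2 y)" by (rule sum_inverse_primes_le_ln_log[OF y])
  also have "(\<Sum>q\<in>?B. real q powr -c) \<le> (\<Sum>q\<in>?B. y powr -c)"
    using c y by (intro sum_mono powr_mono2') auto
  also have "\<dots> \<le> y powr -c * real (card (prime_factors m))"
    using card_mono[of "prime_factors m" ?B] by (simp add: mult.commute mult_left_mono)
  also have "\<dots> \<le> y powr -c * log 2 (real m)"
    using card_prime_factors_le_log[OF m] by (intro mult_left_mono) auto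
  finally show ?thesis by (simp add: mult_left_mono)
qed

text \<open>
  Rankin's trick applied twice: first to the integers \<open>d\<close>, whose prime factors \<open>p\<close> satisfy
  \<open>p - 1 dvd m\<close>, and then to the divisors \<open>p - 1\<close> of \<open>m\<close>.
\<close>

lemma sum_lcm_pred_primes_fiber_le:
  fixes x y c :: real
  assumes m: "m > 0" and c: "1 / 2 \<le> c" "c \<le> 1" and y: "y \<ge> 2" and x: "x \<ge> 1"
  shows "(\<Sum>d | d > 0 \<and> real d \<le> x \<and> lcm_pred_primes d = m. real d powr -c)
    \<le> exp (4 * exp (4 * (y powr (1 - c) * (3 + 2 * ln (log 2 y)) + y powr -c * log 2 x)))"
proof (cases "{d. d > 0 \<and> real d \<le> x \<and> lcm_pred_primes d = m} = {}")
  case True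
  thus ?thesis by (simp only: sum.empty exp_ge_zero)
next
  case False
  then obtain d where d: "d > 0" "real d \<le> x" "lcm_pred_primes d = m" by blast
  \<comment> \<open>A nonempty fibre forces \<open>m \<le> x\<close>, which makes the bound uniform
    in \<open>m\<close>.\<close>
  hence mx: "real m \<le> x" using lcm_pred_primes_le[OF d(1)] by linarith
  let ?D = "{d. d > 0 \<and> real d \<le> x \<and> lcm_pred_primes d = m}"
  define P where "P = {p. prime p \<and> real p \<le> x \<and> p - 1 dvd m}"
  have finx: "finite {d. real d \<le> x}"
    by (rule finite_subset[of _ "{..nat \<lfloor>x\<rfloor>}"]) (auto simp: le_nat_floor)
  have finP: "finite P" by (rule finite_subset[OF _ finx]) (auto simp: P_def)
  have "(\<Sum>d\<in>?D. real d powr -c) \<le> exp (4 * (\<Sum>p\<in>P. real p powr -c))"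
  proof (rule sum_powr_le_exp[OF finP])
    show "finite ?D" by (rule finite_subset[OF _ finx]) auto
    fix d assume d: "d \<in> ?D"
    show "prime_factors d \<subseteq> P"
    proof
      fix p assume "p \<in> prime_factors d"
      hence p: "prime p" "p dvd d" by auto
      have "p \<le> d" using p d by (intro dvd_imp_le) auto
      moreover have "p - 1 dvd m" using prime_minus_1_dvd_lcm_pred_primes[OF p] d by simp
      ultimately show "p \<in> P" using p d by (auto simp: P_def)
    qed
  qed (use c in \<open>auto simp: P_def\<close>)
  also have "(\<Sum>p\<in>P. real p powr -c) \<le> (\<Sum>p\<in>P. real (p - 1) powr -c)"
  proof (rule sum_mono)
    fix p assume "p \<in> P"
    hence "p > 1" using prime_gt_1_nat[of p] by (auto simp: P_def)
    thus "real p powr -c \<le> real (p - 1) powr -c" using c by (intro powr_mono2') auto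
  qed
  also have "\<dots> = (\<Sum>e\<in>(\<lambda>p. p - 1) ` P. real e powr -c)"
  proof -
    have "inj_on (\<lambda>p. p - 1) P"
      by (rule inj_onI) (auto simp: P_def dest!: prime_gt_0_nat)
    thus ?thesis by (simp add: sum.reindex)
  qed
  also have "\<dots> \<le> (\<Sum>e | e dvd m. real e powr -c)"
    using m by (intro sum_mono2) (auto simp: P_def)
  also have "\<dots> \<le> exp (4 * (\<Sum>q\<in>prime_factors m. real q powr -c))"
  proof (rule sum_powr_le_exp)
    fix e assume "e \<in> {e. e dvd m}"
    thus "prime_factors e \<subseteq> prime_factors m" using m by (intro dvd_prime_factors) auto
  qed (use m c in auto)
  also have "(\<Sum>q\<in>prime_factors m. real q powr -c)
      \<le> y powr (1 - c) * (3 + 2 * ln (log 2 y)) + y powr -c * log 2 (real m)"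
    using c by (intro sum_prime_factors_powr_le m y) auto
  also have "y powr -c * log 2 (real m) \<le> y powr -c * log 2 x"
    using m mx by (intro mult_left_mono) auto
  finally show ?thesis by (simp add: mult_left_mono)
qed

text \<open>With \<open>u = ln x\<close>, \<open>v = ln u\<close>, \<open>w = ln v\<close> and
  \<open>\<Lambda> = exp (u * w / v)\<close>, the choices are \<open>y = u\<close> and
  \<open>c = 1 - \<delta>\<close> for \<open>\<delta> = (1 - \<epsilon>) * w / v\<close>. Then
  \<open>u powr \<delta> = v powr (1 - \<epsilon>)\<close>, so the fibre bound is at most
  \<open>exp (4 * exp (v / 2))\<close>, negligible against any power of \<open>\<Lambda>\<close>,
  while \<open>x powr -\<delta>\<close> is \<open>\<Lambda> powr -(1 - \<epsilon>)\<close>.\<close>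

lemma eventually_sum_card_fermat_bases_le:
  fixes \<epsilon> :: real
  assumes \<epsilon>: "0 < \<epsilon>" "\<epsilon> < 1"
  shows "\<forall>\<^sub>F x in at_top. (\<Sum>n | n > 1 \<and> \<not> prime n \<and> real n < x. real (card (fermat_bases n)))
           \<le> x\<^sup>2 * script_L x powr (- 1 + 2 * \<epsilon>)"
proof -
  \<comment> \<open>\<open>3 - 2 * ln (ln 2)\<close> comes from the primes up to \<open>y\<close>,
    and \<open>1 / ln 2\<close> from the prime factors beyond \<open>y\<close>.\<close>
  define C where "C = 3 - 2 * ln (ln 2) + 1 / ln (2::real)"
  \<comment> \<open>The requirements are stated in \<open>v\<close>, with \<open>exp v\<close> for
    \<open>ln x\<close>. In order they serve the fibre bound, \<open>\<delta> \<le> 1/2\<close>,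
    \<open>\<Lambda> ^ 3 \<le> x\<close>, the term \<open>(4 + ln x) / \<Lambda>\<close>, the Rankin
    term, and \<open>w > 0\<close>.\<close>
  have "\<forall>\<^sub>F v::real in at_top. v powr (1 - \<epsilon>) * (C + 2 * ln v) \<le> v / 8"
    using \<epsilon> by real_asymp
  moreover have "\<forall>\<^sub>F v::real in at_top. (1 - \<epsilon>) * ln v / v \<le> 1 / 2" by real_asymp
  moreover have "\<forall>\<^sub>F v::real in at_top. 3 * ln v \<le> v" by real_asymp
  moreover have "\<forall>\<^sub>F v::real in at_top. 2 * (4 + exp v) \<le> exp (2 * \<epsilon> * (exp v * ln v / v))"
    using \<epsilon> by real_asymp
  moreover have "\<forall>\<^sub>F v::real in at_top. ln 2 + 2 * ln (1 + exp v) + 4 * exp (v / 2)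
       + 3 * (exp v * (ln v / v)\<^sup>2) \<le> \<epsilon> * (exp v * ln v / v)"
    using \<epsilon> by real_asymp
  moreover have "\<forall>\<^sub>F v::real in at_top. v > 1" by real_asymp
  ultimately have "\<forall>\<^sub>F v::real in at_top. v powr (1 - \<epsilon>) * (C + 2 * ln v) \<le> v / 8 \<and>
     (1 - \<epsilon>) * ln v / v \<le> 1 / 2 \<and> 3 * ln v \<le> v \<and> 2 * (4 + exp v) \<le> exp (2 * \<epsilon> * (exp v * ln v / v)) \<and>
     ln 2 + 2 * ln (1 + exp v) + 4 * exp (v / 2) + 3 * (exp v * (ln v / v)\<^sup>2)
       \<le> \<epsilon> * (exp v * ln v / v) \<and> v > 1" (is "eventually ?P at_top")
    by eventually_elim blast
  moreover have "filterlim (\<lambda>x::real. ln (ln x)) at_top at_top" by real_asymp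
  ultimately have "\<forall>\<^sub>F x in at_top. ?P (ln (ln x))" by (rule eventually_compose_filterlim)
  moreover have "\<forall>\<^sub>F x::real in at_top. ln x > 2" by real_asymp
  moreover have "\<forall>\<^sub>F x::real in at_top. x > 1" by real_asymp
  ultimately show ?thesis
  proof eventually_elim
    case (elim x)
    define u where "u = ln x"
    define v where "v = ln u"
    define w where "w = ln v"
    have x: "x > 1" "x = exp u" and u: "u > 2" "u = exp v" and P: "?P v"
      using elim by (auto simp: u_def v_def)
    from P have v: "v > 1" by blast
    have w: "w > 0" using v by (simp add: w_def)
    from P have P1: "v powr (1 - \<epsilon>) * (C + 2 * ln v) \<le> v / 8"
      and P2: "(1 - \<epsilon>) * w / v \<le> 1 / 2" and P3: "3 * w \<le> v"
      and P4: "2 * (4 + u) \<le> exp (2 * \<epsilon> * (u * w / v))"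
      and P5: "ln 2 + 2 * ln (1 + u) + 4 * exp (v / 2) + 3 * (u * (w / v)\<^sup>2) \<le> \<epsilon> * (u * w / v)"
      unfolding w_def u(2) [symmetric] by blast+
    define \<Lambda> where "\<Lambda> = script_L x"
    define \<delta> where "\<delta> = (1 - \<epsilon>) * w / v"
    have \<Lambda>: "\<Lambda> = exp (u * w / v)" by (simp add: \<Lambda>_def script_L_def u_def v_def w_def)
    have \<delta>: "0 < \<delta>" "\<delta> \<le> 1 / 2" using P2 w v \<epsilon> by (simp_all add: \<delta>_def)
    have \<Lambda>1: "\<Lambda> \<ge> 1" using u(1) v w by (simp add: \<Lambda>)
    have \<Lambda>3: "\<Lambda> ^ 3 = exp (3 * (u * w / v))" by (simp add: \<Lambda> flip: exp_of_nat_mult)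
    have "u * (3 * w) \<le> u * v" using u(1) P3 by (intro mult_left_mono) auto
    hence "\<Lambda> ^ 3 \<le> x" using v by (simp add: \<Lambda>3 x field_simps)
    have udelta: "u powr \<delta> = v powr (1 - \<epsilon>)"
      using u v by (simp add: powr_def \<delta>_def w_def flip: v_def)
    have log2u: "ln (log 2 u) = w - ln (ln 2)"
      using v by (simp add: log_def w_def ln_div flip: v_def)
    \<comment> \<open>The innermost exponent of the fibre bound without its factor 4, at
      \<open>y = u\<close> and \<open>c = 1 - \<delta>\<close>.\<close>
    define B where "B = u powr (1 - (1 - \<delta>)) * (3 + 2 * ln (log 2 u)) + u powr -(1 - \<delta>) * log 2 x"
    have "B = v powr (1 - \<epsilon>) * (3 + 2 * (w - ln (ln 2))) + u powr \<delta> * u powr -1 * (u / ln 2)"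
    proof -
      have "u powr -(1 - \<delta>) = u powr \<delta> * u powr -1"
        using powr_add[of u \<delta> "-1"] by simp
      moreover have "log 2 x = u / ln 2" by (simp add: log_def u_def)
      ultimately show ?thesis using udelta log2u by (simp add: B_def)
    qed
    also have "u powr \<delta> * u powr -1 * (u / ln 2) = v powr (1 - \<epsilon>) / ln 2"
      using u(1) by (simp add: udelta powr_minus)
    also have "v powr (1 - \<epsilon>) * (3 + 2 * (w - ln (ln 2))) + v powr (1 - \<epsilon>) / ln 2
        = v powr (1 - \<epsilon>) * (C + 2 * ln v)"
      by (simp add: C_def w_def algebra_simps)
    also have "\<dots> \<le> v / 8" by (rule P1)
    finally have "exp (4 * exp (4 * B)) \<le> exp (4 * exp (v / 2))" by simp
    hence T: "(\<Sum>d | d > 0 \<and> real d \<le> x \<and> lcm_pred_primes d = m. real d powr -(1 - \<delta>)) \<le> exp (4 * exp (v / 2))"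
      if "m > 0" for m
      using sum_lcm_pred_primes_fiber_le[OF that, of "1 - \<delta>" u x] \<delta> u(1) x(1)
      by (intro order.trans[OF _ \<open>exp (4 * exp (4 * B)) \<le> _\<close>]) (simp add: B_def)
    have "(\<Sum>n | n > 1 \<and> \<not> prime n \<and> real n < x. real (card (fermat_bases n)))
         \<le> x\<^sup>2 * ((4 + ln x) / \<Lambda> + (1 + ln x)\<^sup>2 * (exp (4 * exp (v / 2)) * (x / \<Lambda> ^ 3) powr ((1 - \<delta>) - 1)))"
      using x(1) \<Lambda>1 \<open>\<Lambda> ^ 3 \<le> x\<close> \<delta> T by (intro sum_card_fermat_bases_le) auto
    also have "\<dots> \<le> x\<^sup>2 * \<Lambda> powr (- 1 + 2 * \<epsilon>)"
    proof (rule mult_left_mono)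
      \<comment> \<open>Each of the two summands is shown to be at most half of the target.\<close>
      have "(4 + u) / \<Lambda> \<le> exp (2 * \<epsilon> * (u * w / v)) / 2 / \<Lambda>"
        using \<Lambda>1 P4 by (intro divide_right_mono) auto
      also have "\<dots> = \<Lambda> powr (- 1 + 2 * \<epsilon>) / 2"
        by (simp add: \<Lambda> powr_def algebra_simps exp_diff flip: exp_add exp_diff)
      finally have 1: "(4 + ln x) / \<Lambda> \<le> \<Lambda> powr (- 1 + 2 * \<epsilon>) / 2" by (simp add: u_def)
      have "x / \<Lambda> ^ 3 = exp (u - 3 * (u * w / v))" by (simp add: \<Lambda>3 x exp_diff)
      hence "(x / \<Lambda> ^ 3) powr ((1 - \<delta>) - 1) = exp (- \<delta> * (u - 3 * (u * w / v)))"
        by (simp add: powr_def)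
      \<comment> \<open>The first term is the saving in the exponent; the second is the loss from
        dividing \<open>x\<close> by \<open>\<Lambda> ^ 3\<close>, smaller by a factor of order
        \<open>w / v\<close>.\<close>
      also have "- \<delta> * (u - 3 * (u * w / v)) = - (1 - \<epsilon>) * (u * w / v) + 3 * (1 - \<epsilon>) * (u * (w / v)\<^sup>2)"
        using v by (simp add: \<delta>_def power2_eq_square field_simps)
      also have "exp \<dots> \<le> exp (- (1 - \<epsilon>) * (u * w / v) + 3 * (u * (w / v)\<^sup>2))"
      proof -
        have "3 * (1 - \<epsilon>) * (u * (w / v)\<^sup>2) \<le> 3 * (u * (w / v)\<^sup>2)"
          using \<epsilon> u(1) by (intro mult_right_mono) auto
        thus ?thesis by (simp only: exp_le_cancel_iff add_left_mono)
      qed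
      finally have "(1 + ln x)\<^sup>2 * (exp (4 * exp (v / 2)) * (x / \<Lambda> ^ 3) powr ((1 - \<delta>) - 1))
         \<le> (1 + ln x)\<^sup>2 * (exp (4 * exp (v / 2)) * exp (- (1 - \<epsilon>) * (u * w / v) + 3 * (u * (w / v)\<^sup>2)))"
        by (intro mult_left_mono) auto
      also have sq: "(1 + ln x)\<^sup>2 = exp (2 * ln (1 + u))"
        using u(1) by (simp add: u_def exp_double)
      also have "exp (2 * ln (1 + u)) * (exp (4 * exp (v / 2)) * exp (- (1 - \<epsilon>) * (u * w / v) + 3 * (u * (w / v)\<^sup>2)))
          = exp (2 * ln (1 + u) + 4 * exp (v / 2) + 3 * (u * (w / v)\<^sup>2) - (1 - \<epsilon>) * (u * w / v))"
      proof -
        have "exp a * (exp b * exp (- (1 - \<epsilon>) * q + r)) = exp (a + b + r - (1 - \<epsilon>) * q)" for a b q r :: real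
          by (simp add: algebra_simps flip: exp_add)
        thus ?thesis .
      qed
      also have "\<dots> \<le> exp ((- 1 + 2 * \<epsilon>) * (u * w / v) - ln 2)"
      proof -
        have "a + b + r - (1 - \<epsilon>) * q \<le> (- 1 + 2 * \<epsilon>) * q - ln 2"
          if "ln 2 + a + b + r \<le> \<epsilon> * q" for a b q r :: real
          using that by (simp add: algebra_simps)
        thus ?thesis using P5 unfolding exp_le_cancel_iff .
      qed
      also have "\<dots> = \<Lambda> powr (- 1 + 2 * \<epsilon>) / 2" by (simp add: \<Lambda> powr_def exp_diff)
      finally have 2: "exp (2 * ln (1 + u)) * (exp (4 * exp (v / 2)) * (x / \<Lambda> ^ 3) powr ((1 - \<delta>) - 1))
          \<le> \<Lambda> powr (- 1 + 2 * \<epsilon>) / 2" .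
      show "(4 + ln x) / \<Lambda> + (1 + ln x)\<^sup>2 * (exp (4 * exp (v / 2)) * (x / \<Lambda> ^ 3) powr ((1 - \<delta>) - 1))
          \<le> \<Lambda> powr (- 1 + 2 * \<epsilon>)"
        using add_mono[OF 1 2] unfolding sq by simp
    qed simp
    finally show ?case unfolding \<Lambda>_def .
  qed
qed

text \<open>Solving \<open>S x = A x * \<Lambda> x powr (- 1 + \<epsilon> x)\<close> for the
  exponent and cutting it off below at 0 gives the witness; the bounds for fixed
  \<open>\<epsilon>\<close> make it tend to 0. Where \<open>S x = 0\<close> there is nothing to
  solve and 0 is taken.\<close>

lemma exists_o1_exponent:
  fixes S A \<Lambda> :: "real \<Rightarrow> real"
  assumes S: "\<And>x. S x \<ge> 0" and A: "\<forall>\<^sub>F x in at_top. A x > 0" and \<Lambda>: "\<forall>\<^sub>F x in at_top. \<Lambda> x > 1"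
    and bound: "\<And>\<epsilon>. \<epsilon> > 0 \<Longrightarrow> \<forall>\<^sub>F x in at_top. S x \<le> A x * \<Lambda> x powr (- 1 + \<epsilon>)"
  obtains \<epsilon> where "(\<epsilon> \<longlongrightarrow> 0) at_top" "\<forall>\<^sub>F x in at_top. S x \<le> A x * \<Lambda> x powr (- 1 + \<epsilon> x)"
proof
  define \<epsilon> where "\<epsilon> x = (if S x = 0 then 0 else max 0 (1 + ln (S x / A x) / ln (\<Lambda> x)))" for x
  show "(\<epsilon> \<longlongrightarrow> 0) at_top"
  proof (rule tendstoI)
    fix e :: real assume e: "e > 0"
    show "\<forall>\<^sub>F x in at_top. dist (\<epsilon> x) 0 < e"
      using bound[OF half_gt_zero[OF e]] A \<Lambda>
    proof eventually_elim
      case (elim x)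
      have "\<bar>\<epsilon> x\<bar> < e"
      proof (cases "S x = 0")
        case False
        hence Sx: "S x > 0" using S[of x] by simp
        have "S x / A x \<le> \<Lambda> x powr (- 1 + e / 2)" using elim by (simp add: field_simps)
        hence "ln (S x / A x) \<le> ln (\<Lambda> x powr (- 1 + e / 2))" using Sx elim by (subst ln_le_cancel_iff) auto
        also have "\<dots> = (- 1 + e / 2) * ln (\<Lambda> x)" using elim by (simp add: ln_powr)
        finally have "ln (S x / A x) / ln (\<Lambda> x) \<le> - 1 + e / 2"
          using elim by (simp add: divide_le_eq)
        thus ?thesis using e by (simp add: \<epsilon>_def)
      qed (use e in \<open>simp add: \<epsilon>_def\<close>)
      thus ?case by simp
    qed
  qed
  show "\<forall>\<^sub>F x in at_top. S x \<le> A x * \<Lambda> x powr (- 1 + \<epsilon> x)"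
    using A \<Lambda>
  proof eventually_elim
    case (elim x)
    show ?case
    proof (cases "S x = 0")
      case False
      hence Sx: "S x > 0" using S[of x] by simp
      have "S x = A x * \<Lambda> x powr (ln (S x / A x) / ln (\<Lambda> x))"
        using Sx elim by (simp add: powr_def)
      also have "\<dots> \<le> A x * \<Lambda> x powr (- 1 + \<epsilon> x)"
        using elim False by (intro mult_left_mono powr_mono) (auto simp: \<epsilon>_def)
      finally show ?thesis .
    qed (use elim in simp)
  qed
qed

subsection \<open>Endomorphisms of residue rings of polynomials\<close>

text \<open>The ideal generated by \<open>int n\<close> and \<open>F\<close> among the integer
  polynomials; congruence modulo it is equality in \<open>(\<int>/n\<int>)[x]/(F)\<close>.\<close>

definition mod_ideal :: "nat \<Rightarrow> int poly \<Rightarrow> int poly set" where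
  "mod_ideal n F = {F * q + smult (int n) r |q r. True}"

lemma mod_idealI: "g = F * q + smult (int n) r \<Longrightarrow> g \<in> mod_ideal n F"
  unfolding mod_ideal_def by blast

lemma mod_idealE:
  assumes "g \<in> mod_ideal n F"
  obtains q r where "g = F * q + smult (int n) r"
  using assms unfolding mod_ideal_def by blast

lemma mod_ideal_0: "0 \<in> mod_ideal n F"
  by (rule mod_idealI[of _ _ 0 _ 0]) simp

lemma mod_ideal_add: "g \<in> mod_ideal n F \<Longrightarrow> h \<in> mod_ideal n F \<Longrightarrow> g + h \<in> mod_ideal n F"
proof (elim mod_idealE)
  fix q r q' r' assume "g = F * q + smult (int n) r" "h = F * q' + smult (int n) r'"
  thus "g + h \<in> mod_ideal n F"
    by (intro mod_idealI[of _ _ "q + q'" _ "r + r'"]) (simp add: smult_add_right algebra_simps)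
qed

lemma mod_ideal_mult: "g \<in> mod_ideal n F \<Longrightarrow> k * g \<in> mod_ideal n F"
proof (elim mod_idealE)
  fix q r assume "g = F * q + smult (int n) r"
  thus "k * g \<in> mod_ideal n F"
    by (intro mod_idealI[of _ _ "k * q" _ "k * r"]) (simp add: algebra_simps)
qed

lemma mod_ideal_uminus: "g \<in> mod_ideal n F \<Longrightarrow> - g \<in> mod_ideal n F"
  using mod_ideal_mult[of g n F "- 1"] by simp

lemma mod_ideal_diff: "g \<in> mod_ideal n F \<Longrightarrow> h \<in> mod_ideal n F \<Longrightarrow> g - h \<in> mod_ideal n F"
  using mod_ideal_add[of g n F "- h"] mod_ideal_uminus[of h n F] by simp

lemma mod_ideal_smult: "g \<in> mod_ideal n F \<Longrightarrow> smult c g \<in> mod_ideal n F"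
  using mod_ideal_mult[of g n F "[:c:]"] by simp

lemma mod_ideal_sum: "(\<And>i. i \<in> A \<Longrightarrow> g i \<in> mod_ideal n F) \<Longrightarrow> sum g A \<in> mod_ideal n F"
  by (induction A rule: infinite_finite_induct) (auto simp: mod_ideal_0 mod_ideal_add)

lemma mod_ideal_pcompose_diff:
  assumes "h - k \<in> mod_ideal n F"
  shows "pcompose p h - pcompose p k \<in> mod_ideal n F"
proof (induction p)
  case (pCons a p)
  have "pcompose (pCons a p) h - pcompose (pCons a p) k
      = h * (pcompose p h - pcompose p k) + pcompose p k * (h - k)"
    by (simp add: pcompose_pCons algebra_simps)
  thus ?case using pCons assms by (metis mod_ideal_add mod_ideal_mult)
qed (simp add: mod_ideal_0)

lemma Mp_eq_iff:
  "poly_mod.Mp (int n) g = poly_mod.Mp (int n) h \<longleftrightarrow> (\<exists>r. g - h = smult (int n) r)"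
proof
  assume eq: "poly_mod.Mp (int n) g = poly_mod.Mp (int n) h"
  have "int n dvd coeff (g - h) i" for i
    using arg_cong[OF eq, of "\<lambda>p. coeff p i"]
    by (simp add: poly_mod.Mp_coeff poly_mod.M_def mod_eq_dvd_iff)
  hence "[:int n:] dvd g - h" by (simp add: const_poly_dvd_iff)
  thus "\<exists>r. g - h = smult (int n) r" by (auto simp: dvd_def)
next
  assume "\<exists>r. g - h = smult (int n) r"
  then obtain r where "g = h + smult (int n) r" by (auto simp: algebra_simps)
  thus "poly_mod.Mp (int n) g = poly_mod.Mp (int n) h"
    by (intro poly_eqI) (simp add: poly_mod.Mp_coeff poly_mod.M_def)
qed

lemma mod_ideal_if_Mp_eq:
  assumes "poly_mod.Mp (int n) g = poly_mod.Mp (int n) (F * h)"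
  shows "g \<in> mod_ideal n F"
proof -
  obtain r where "g - F * h = smult (int n) r" using assms by (auto simp: Mp_eq_iff)
  thus ?thesis by (intro mod_idealI[of _ _ h _ r]) (simp add: algebra_simps)
qed

definition monic_rem :: "int poly \<Rightarrow> int poly \<Rightarrow> int poly" where
  "monic_rem F g = snd (pseudo_divmod g F)"

lemma monic_rem:
  assumes "monic F"
  shows "\<exists>q. g = F * q + monic_rem F g" and "degree F \<le> j \<Longrightarrow> coeff (monic_rem F g) j = 0"
proof -
  have F0: "F \<noteq> 0" using assms by auto
  obtain Q R where QR: "pseudo_divmod g F = (Q, R)" by force
  have "g = F * Q + R" and R: "R = 0 \<or> degree R < degree F"
    using pseudo_divmod[OF F0 QR] assms by auto
  moreover have "monic_rem F g = R" by (simp add: monic_rem_def QR)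
  ultimately show "\<exists>q. g = F * q + monic_rem F g" "degree F \<le> j \<Longrightarrow> coeff (monic_rem F g) j = 0"
    by (metis, auto intro: coeff_eq_0)
qed

lemma diff_monic_rem_in_mod_ideal: "monic F \<Longrightarrow> g - monic_rem F g \<in> mod_ideal n F"
proof -
  assume "monic F"
  then obtain q where "g = F * q + monic_rem F g" using monic_rem(1) by blast
  hence "g - monic_rem F g = F * q + smult (int n) 0" by (simp add: algebra_simps)
  thus ?thesis by (rule mod_idealI)
qed

text \<open>Uniqueness of remainders modulo \<open>n\<close>: reducing \<open>r\<close> by
  \<open>F\<close> gives \<open>g = F * Q + smult (int n) s\<close> with \<open>s\<close> of low
  degree, and the leading coefficient of \<open>F * Q\<close> then forces
  \<open>Q = 0\<close>.\<close>

lemma dvd_coeff_if_in_mod_ideal: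
  assumes F: "monic F" and g: "g \<in> mod_ideal n F" and deg: "\<And>j. degree F \<le> j \<Longrightarrow> coeff g j = 0"
  shows "int n dvd coeff g j"
proof -
  obtain q r where qr: "g = F * q + smult (int n) r" using g by (rule mod_idealE)
  obtain q' where q': "r = F * q' + monic_rem F r" using monic_rem(1)[OF F] by blast
  define Q where "Q = q + smult (int n) q'"
  define s where "s = monic_rem F r"
  have r: "r = F * q' + s" using q' by (simp add: s_def)
  have eq: "g = F * Q + smult (int n) s"
    by (simp add: qr r Q_def smult_add_right algebra_simps)
  have "Q = 0"
  proof (rule ccontr)
    assume "Q \<noteq> 0"
    have "coeff (F * Q) (degree F + degree Q) = lead_coeff Q" using F by (simp add: coeff_mult_degree_sum)
    moreover have "coeff (F * Q) (degree F + degree Q) = 0"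
    proof -
      have "F * Q = g - smult (int n) s" by (simp add: eq)
      thus ?thesis using deg monic_rem(2)[OF F] by (simp add: s_def)
    qed
    ultimately show False using \<open>Q \<noteq> 0\<close> by simp
  qed
  thus ?thesis using eq by simp
qed

lemma cong_coeff_monic_rem:
  assumes F: "monic F" and g: "g - h \<in> mod_ideal n F"
  shows "[coeff (monic_rem F g) j = coeff (monic_rem F h) j] (mod int n)"
proof -
  have "(g - h) - (g - monic_rem F g) + (h - monic_rem F h) \<in> mod_ideal n F"
    using mod_ideal_add[OF mod_ideal_diff[OF g diff_monic_rem_in_mod_ideal[OF F]]
        diff_monic_rem_in_mod_ideal[OF F]] .
  hence "monic_rem F g - monic_rem F h \<in> mod_ideal n F" by simp
  hence "int n dvd coeff (monic_rem F g - monic_rem F h) j"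
    using monic_rem(2)[OF F] by (intro dvd_coeff_if_in_mod_ideal[OF F]) auto
  thus ?thesis by (simp add: cong_iff_dvd_diff)
qed

lemma monic_rem_small:
  assumes F: "monic F" and "\<And>j. degree F \<le> j \<Longrightarrow> coeff g j = 0"
  shows "monic_rem F g = g"
proof -
  \<comment> \<open>Modulus 0: the ideal is generated by \<open>F\<close> alone, and divisibility by
    0 means vanishing.\<close>
  have "g - monic_rem F g \<in> mod_ideal 0 F" using F by (rule diff_monic_rem_in_mod_ideal)
  hence "int 0 dvd coeff (g - monic_rem F g) j" for j
    using assms monic_rem(2)[OF F] by (intro dvd_coeff_if_in_mod_ideal[OF F]) auto
  thus ?thesis by (simp add: poly_eq_iff)
qed

text \<open>Linear maps that induce an endomorphism of the module \<open>(\<int>/n\<int>)[x]/(F)\<close>.\<close>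

definition quot_endo :: "nat \<Rightarrow> int poly \<Rightarrow> (int poly \<Rightarrow> int poly) \<Rightarrow> bool" where
  "quot_endo n F \<phi> \<longleftrightarrow> (\<forall>a b. \<phi> (a + b) = \<phi> a + \<phi> b) \<and> (\<forall>c a. \<phi> (smult c a) = smult c (\<phi> a)) \<and>
     (\<forall>a\<in>mod_ideal n F. \<phi> a \<in> mod_ideal n F)"

lemma quot_endo_0: "quot_endo n F \<phi> \<Longrightarrow> \<phi> 0 = 0"
  unfolding quot_endo_def by (metis smult_0_left)

lemma quot_endo_diff: "quot_endo n F \<phi> \<Longrightarrow> \<phi> (a - b) = \<phi> a - \<phi> b"
  unfolding quot_endo_def by (metis add_diff_cancel_right' diff_add_cancel)

lemma quot_endo_sum:
  assumes "quot_endo n F \<phi>"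
  shows "\<phi> (\<Sum>i\<in>A. smult (c i) (g i)) = (\<Sum>i\<in>A. smult (c i) (\<phi> (g i)))"
  by (induction A rule: infinite_finite_induct)
     (use assms quot_endo_0[OF assms] in \<open>auto simp: quot_endo_def\<close>)

lemma quot_endo_comp: "quot_endo n F \<phi> \<Longrightarrow> quot_endo n F \<psi> \<Longrightarrow> quot_endo n F (\<psi> \<circ> \<phi>)"
  by (auto simp: quot_endo_def)

lemma quot_endo_id: "quot_endo n F id"
  by (auto simp: quot_endo_def)

lemma quot_endo_funpow: "quot_endo n F \<phi> \<Longrightarrow> quot_endo n F (\<phi> ^^ k)"
  by (induction k) (auto intro: quot_endo_comp quot_endo_id)

lemma quot_endo_mult: "quot_endo n F ((*) k)"
  by (simp add: quot_endo_def mod_ideal_mult distrib_left)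

lemma quot_endo_pcompose:
  assumes "pcompose F h \<in> mod_ideal n F"
  shows "quot_endo n F (\<lambda>g. pcompose g h)"
  unfolding quot_endo_def
proof (intro conjI allI ballI)
  fix a assume "a \<in> mod_ideal n F"
  then obtain q r where "a = F * q + smult (int n) r" by (rule mod_idealE)
  hence "pcompose a h = pcompose q h * pcompose F h + smult (int n) (pcompose r h)"
    by (simp add: pcompose_add pcompose_mult pcompose_smult mult.commute)
  moreover have "smult (int n) (pcompose r h) \<in> mod_ideal n F"
    by (rule mod_idealI[of _ _ 0]) simp
  ultimately show "pcompose a h \<in> mod_ideal n F"
    using assms by (simp add: mod_ideal_add mod_ideal_mult)
qed (simp_all add: pcompose_add pcompose_smult)

text \<open>Images of the basis are rows, so that the matrix of \<open>\<psi> \<circ> \<phi>\<close> is that of \<open>\<phi>\<close> times that of \<open>\<psi>\<close>.\<close>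

definition quot_mat :: "int poly \<Rightarrow> (int poly \<Rightarrow> int poly) \<Rightarrow> int mat" where
  "quot_mat F \<phi> = mat (degree F) (degree F) (\<lambda>(i, j). coeff (monic_rem F (\<phi> (monom 1 i))) j)"

lemma quot_mat_carrier [simp]: "quot_mat F \<phi> \<in> carrier_mat (degree F) (degree F)"
  by (simp add: quot_mat_def)

section \<open>Determinants of induced endomorphisms modulo n\<close>

lemma det_cong_mod:
  fixes A B :: "int mat"
  assumes A: "A \<in> carrier_mat d d" and B: "B \<in> carrier_mat d d"
    and "\<And>i j. i < d \<Longrightarrow> j < d \<Longrightarrow> [A $$ (i, j) = B $$ (i, j)] (mod m)"
  shows "[Determinant.det A = Determinant.det B] (mod m)"
  unfolding det_def'[OF A] det_def'[OF B]
proof (intro cong_sum cong_mult cong_refl cong_prod)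
  fix p i assume "p \<in> {p. p permutes {0..<d}}" "i \<in> {0..<d}"
  hence "i < d" "p i < d" by (auto simp: permutes_in_image dest: permutes_in_image[of p _ i])
  thus "[A $$ (i, p i) = B $$ (i, p i)] (mod m)" by (rule assms(3))
qed

text \<open>Expanding the remainder of \<open>g\<close> in powers of \<open>x\<close> and applying
  \<open>\<phi>\<close> termwise gives an element congruent to \<open>\<phi> g\<close>; with reduced
  basis images it is itself reduced, so the coordinates agree. Thus \<open>quot_mat F \<phi>\<close>
  acts on coordinate rows from the right.\<close>

lemma cong_coeff_quot_endo:
  assumes F: "monic F" and \<phi>: "quot_endo n F \<phi>"
  shows "[(\<Sum>i<degree F. coeff (monic_rem F g) i * coeff (monic_rem F (\<phi> (monom 1 i))) j)
           = coeff (monic_rem F (\<phi> g)) j] (mod int n)"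
proof -
  let ?r = "monic_rem F g"
  let ?s = "\<Sum>i<degree F. smult (coeff ?r i) (monic_rem F (\<phi> (monom 1 i)))"
  have "?r = (\<Sum>i<degree F. smult (coeff ?r i) (monom 1 i))"
    using monic_rem(2)[OF F] by (intro poly_eqI) (auto simp: coeff_sum if_distrib sum.delta cong: if_cong)
  hence "\<phi> ?r = (\<Sum>i<degree F. smult (coeff ?r i) (\<phi> (monom 1 i)))"
    using quot_endo_sum[OF \<phi>, of "coeff ?r" "monom 1" "{..<degree F}"] by simp
  hence "\<phi> ?r - ?s = (\<Sum>i<degree F. smult (coeff ?r i) (\<phi> (monom 1 i) - monic_rem F (\<phi> (monom 1 i))))"
    by (simp add: smult_diff_right sum_subtractf)
  hence 1: "\<phi> ?r - ?s \<in> mod_ideal n F"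
    by (simp add: mod_ideal_sum mod_ideal_smult diff_monic_rem_in_mod_ideal F)
  have "\<phi> (g - ?r) \<in> mod_ideal n F"
    using \<phi> diff_monic_rem_in_mod_ideal[OF F, of g n] by (auto simp: quot_endo_def)
  hence 2: "\<phi> g - \<phi> ?r \<in> mod_ideal n F" by (simp add: quot_endo_diff[OF \<phi>])
  have "?s - \<phi> g \<in> mod_ideal n F"
    using mod_ideal_uminus[OF mod_ideal_add[OF 1 2]] by simp
  hence "[coeff (monic_rem F ?s) j = coeff (monic_rem F (\<phi> g)) j] (mod int n)"
    by (rule cong_coeff_monic_rem[OF F])
  moreover have "monic_rem F ?s = ?s"
    using monic_rem(2)[OF F] by (intro monic_rem_small[OF F]) (simp add: coeff_sum)
  ultimately show ?thesis by (simp add: coeff_sum)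
qed

lemma det_quot_mat_comp:
  assumes F: "monic F" and \<psi>: "quot_endo n F \<psi>"
  shows "[Determinant.det (quot_mat F \<phi>) * Determinant.det (quot_mat F \<psi>)
    = Determinant.det (quot_mat F (\<psi> \<circ> \<phi>))] (mod int n)"
proof -
  have "[Determinant.det (quot_mat F \<phi> * quot_mat F \<psi>) = Determinant.det (quot_mat F (\<psi> \<circ> \<phi>))] (mod int n)"
  proof (rule det_cong_mod)
    fix i j assume ij: "i < degree F" "j < degree F"
    have "(quot_mat F \<phi> * quot_mat F \<psi>) $$ (i, j) = (\<Sum>k<degree F.
        coeff (monic_rem F (\<phi> (monom 1 i))) k * coeff (monic_rem F (\<psi> (monom 1 k))) j)"
      using ij by (simp add: quot_mat_def scalar_prod_def atLeast0LessThan)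
    moreover have "quot_mat F (\<psi> \<circ> \<phi>) $$ (i, j) = coeff (monic_rem F (\<psi> (\<phi> (monom 1 i)))) j"
      using ij by (simp add: quot_mat_def)
    ultimately show "[(quot_mat F \<phi> * quot_mat F \<psi>) $$ (i, j) = quot_mat F (\<psi> \<circ> \<phi>) $$ (i, j)] (mod int n)"
      using cong_coeff_quot_endo[OF F \<psi>, of "\<phi> (monom 1 i)" j] by simp
  qed (intro mult_carrier_mat[of _ _ "degree F"] quot_mat_carrier)+
  thus ?thesis by (simp add: det_mult[of _ "degree F"])
qed

lemma det_quot_mat_cong:
  assumes F: "monic F" and "\<And>i. i < degree F \<Longrightarrow> \<phi> (monom 1 i) - \<psi> (monom 1 i) \<in> mod_ideal n F"
  shows "[Determinant.det (quot_mat F \<phi>) = Determinant.det (quot_mat F \<psi>)] (mod int n)"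
  using assms by (intro det_cong_mod[of _ "degree F"]) (auto simp: quot_mat_def intro!: cong_coeff_monic_rem)

lemma det_quot_mat_id:
  assumes F: "monic F"
  shows "Determinant.det (quot_mat F id) = 1"
proof -
  have "quot_mat F id = 1\<^sub>m (degree F)"
    using F by (intro eq_matI) (auto simp: quot_mat_def monic_rem_small)
  thus ?thesis by simp
qed

lemma det_quot_mat_funpow:
  assumes F: "monic F" and \<phi>: "quot_endo n F \<phi>"
  shows "[Determinant.det (quot_mat F (\<phi> ^^ k)) = Determinant.det (quot_mat F \<phi>) ^ k] (mod int n)"
proof (induction k)
  case 0
  thus ?case using det_quot_mat_id[OF F] by (simp add: id_def)
next
  case (Suc k)
  have 1: "[Determinant.det (quot_mat F (\<phi> ^^ k)) * Determinant.det (quot_mat F \<phi>) =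
      Determinant.det (quot_mat F (\<phi> ^^ Suc k))] (mod int n)"
    using det_quot_mat_comp[OF F \<phi>, of "\<phi> ^^ k"] by simp
  have 2: "[Determinant.det (quot_mat F (\<phi> ^^ k)) * Determinant.det (quot_mat F \<phi>) =
      Determinant.det (quot_mat F \<phi>) ^ k * Determinant.det (quot_mat F \<phi>)] (mod int n)"
    by (intro cong_mult Suc cong_refl)
  show ?case using cong_trans[OF cong_sym[OF 1] 2] unfolding power_Suc2 .
qed

text \<open>The matrix of multiplication by \<open>x\<close> is the companion matrix of \<open>F\<close>.\<close>

lemma det_quot_mat_x:
  assumes F: "monic F"
  shows "Determinant.det (quot_mat F ((*) (monom 1 1))) = (- 1) ^ degree F * coeff F 0"
proof (cases "degree F = 0")
  case True
  hence "F = 1" using F by (metis monic_degree_0)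
  thus ?thesis by (simp add: quot_mat_def)
next
  case False
  define e where "e = degree F - 1"
  have d: "degree F = Suc e" using False by (simp add: e_def)
  let ?A = "quot_mat F ((*) (monom 1 1))"
  have A: "?A \<in> carrier_mat (Suc e) (Suc e)" using quot_mat_carrier[of F] by (simp add: d)
  have upper: "?A $$ (i, j) = (if j = Suc i then 1 else 0)" if "i < e" "j < Suc e" for i j
  proof -
    have "monic_rem F (monom 1 (Suc i)) = monom 1 (Suc i)"
      using that d by (intro monic_rem_small[OF F]) auto
    thus ?thesis using that by (simp add: quot_mat_def d mult_monom)
  qed
  have last: "?A $$ (e, j) = - coeff F j" if "j < Suc e" for j
  proof -
    have "monic_rem F (monom 1 (Suc e) - F) = monom 1 (Suc e) - F"
    proof (rule monic_rem_small[OF F])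
      fix j assume "degree F \<le> j"
      thus "coeff (monom 1 (Suc e) - F) j = 0"
        using F d by (cases "j = Suc e") (auto simp: coeff_eq_0)
    qed
    moreover have "monom 1 (Suc e) - (monom 1 (Suc e) - F) \<in> mod_ideal 0 F"
      by (intro mod_idealI[of _ _ 1 _ 0]) simp
    ultimately have "[coeff (monic_rem F (monom 1 (Suc e))) j = coeff (monom 1 (Suc e) - F) j] (mod int 0)"
      using cong_coeff_monic_rem[OF F] by metis
    thus ?thesis using that by (simp add: quot_mat_def d mult_monom)
  qed
  \<comment> \<open>In the first column only the last entry \<open>- coeff F 0\<close> can be
    nonzero, and deleting its row and column leaves the identity matrix.\<close>
  have "Determinant.det ?A = (\<Sum>i<Suc e. ?A $$ (i, 0) * Determinant.cofactor ?A i 0)"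
    by (rule laplace_expansion_column[OF A]) simp
  also have "\<dots> = ?A $$ (e, 0) * Determinant.cofactor ?A e 0"
    by (simp add: upper del: One_nat_def)
  also have "mat_delete ?A e 0 = 1\<^sub>m e"
  proof (rule eq_matI)
    fix i j assume ij: "i < dim_row (1\<^sub>m e :: int mat)" "j < dim_col (1\<^sub>m e :: int mat)"
    have "mat_delete ?A e 0 $$ (i, j) = ?A $$ (i, Suc j)"
      using ij A by (auto simp: mat_delete_def)
    also have "\<dots> = 1\<^sub>m e $$ (i, j)" using ij upper[of i "Suc j"] by auto
    finally show "mat_delete ?A e 0 $$ (i, j) = 1\<^sub>m e $$ (i, j)" .
  qed (use A in auto)
  hence "Determinant.cofactor ?A e 0 = (- 1) ^ e" by (simp add: Determinant.cofactor_def)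
  finally have "Determinant.det ?A = ?A $$ (e, 0) * (- 1) ^ e" .
  thus ?thesis using last[of 0] by (simp only: d) simp
qed

section \<open>The Frobenius substitution and multiplication by x\<close>

lemma pcompose_monom_monom: "pcompose (monom 1 j) (monom 1 k) = (monom 1 (k * j) :: int poly)"
  by (induction j) (simp_all add: monom_Suc pcompose_pCons mult_monom del: One_nat_def)

lemma monom_power_cong:
  assumes "monom 1 a - monom 1 1 \<in> mod_ideal n F"
  shows "monom 1 (a * k) - monom 1 k \<in> mod_ideal n F"
  using mod_ideal_pcompose_diff[OF assms, of "monom 1 k"]
  by (simp add: pcompose_monom_monom)

text \<open>Substituting \<open>x ^ n\<close> gives
  \<open>\<sigma> \<circ> \<mu> = (\<mu> ^^ n) \<circ> \<sigma>\<close>, hence \<open>c * s\<close>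
  is congruent to \<open>s * c ^ n\<close>. By \<open>fixed\<close>, the iterate
  \<open>\<sigma> ^^ i\<close> fixes every power of \<open>x\<close> modulo the ideal, so
  \<open>s ^ i\<close> is congruent to 1 and \<open>s\<close> cancels. The companion matrix
  identifies \<open>c\<close>.\<close>

lemma constant_term_cong:
  assumes F: "monic F" and n: "n > 0" and i: "i \<ge> 1"
    and frob: "pcompose F (monom 1 n) \<in> mod_ideal n F" and fixed: "frob_poly n i \<in> mod_ideal n F"
  shows "[((- 1) ^ degree F * coeff F 0) ^ n = (- 1) ^ degree F * coeff F 0] (mod int n)"
proof -
  define \<sigma> :: "int poly \<Rightarrow> int poly" where "\<sigma> = (\<lambda>g. pcompose g (monom 1 n))"
  define \<mu> :: "int poly \<Rightarrow> int poly" where "\<mu> = (*) (monom 1 1)"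
  define c where "c = Determinant.det (quot_mat F \<mu>)"
  define s where "s = Determinant.det (quot_mat F \<sigma>)"
  have \<sigma>: "quot_endo n F \<sigma>" unfolding \<sigma>_def by (rule quot_endo_pcompose[OF frob])
  have \<mu>: "quot_endo n F \<mu>" unfolding \<mu>_def by (rule quot_endo_mult)
  have \<mu>_pow: "(\<mu> ^^ k) g = monom 1 k * g" for k g
    by (induction k) (simp_all add: \<mu>_def mult_monom flip: mult.assoc)
  have \<sigma>_pow: "(\<sigma> ^^ k) (monom 1 j) = monom 1 (n ^ k * j)" for k j
    by (induction k) (simp_all add: \<sigma>_def pcompose_monom_monom mult_ac)
  have "\<sigma> \<circ> \<mu> = (\<mu> ^^ n) \<circ> \<sigma>"
    by (rule ext) (simp add: \<mu>_pow, simp add: \<mu>_def \<sigma>_def pcompose_mult pcompose_monom_monom)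
  hence "[c * s = s * c ^ n] (mod int n)"
    using det_quot_mat_comp[OF F \<sigma>, of \<mu>] det_quot_mat_comp[OF F quot_endo_funpow[OF \<mu>, of n], of \<sigma>]
      cong_mult[OF cong_refl[of s] det_quot_mat_funpow[OF F \<mu>, of n]]
    unfolding c_def s_def by (metis cong_sym cong_trans)
  moreover have "[s ^ i = 1] (mod int n)"
  proof -
    have "[Determinant.det (quot_mat F (\<sigma> ^^ i)) = Determinant.det (quot_mat F id)] (mod int n)"
    proof (rule det_quot_mat_cong[OF F])
      fix j
      show "(\<sigma> ^^ i) (monom 1 j) - id (monom 1 j) \<in> mod_ideal n F"
        using monom_power_cong[of "n ^ i" n F j] fixed by (simp add: \<sigma>_pow frob_poly_def)
    qed
    thus ?thesis using det_quot_mat_funpow[OF F \<sigma>, of i] unfolding s_def det_quot_mat_id[OF F]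
      by (metis cong_sym cong_trans)
  qed
  hence "coprime (s ^ i) (int n)" using cong_imp_coprime[OF cong_sym] by (metis coprime_1_left)
  hence "coprime s (int n)" using i by (simp add: coprime_power_left_iff)
  ultimately have "[c = c ^ n] (mod int n)"
    by (metis cong_mult_lcancel mult.commute)
  thus ?thesis using det_quot_mat_x[OF F] by (simp add: c_def \<mu>_def cong_sym)
qed

subsection \<open>Frobenius pseudoprimes\<close>

text \<open>Both generators of the gcmd ideal, taken with coefficients 1 and 0, are multiples of
  \<open>factor n f i\<close> modulo \<open>n\<close>. By \<open>prev\<close> the second generator
  is already reduced, so division by the monic factor is exact.\<close>

lemma pseudoprime_factor:
  assumes n: "n > 1" and step: "factorization_step f n" and i: "i \<in> {1..degree f}"
    and prev: "poly_mod.Mp (int n) (cofactor n f (i - 1)) = cofactor n f (i - 1)"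
  shows "monic (factor n f i)" "frob_poly n i \<in> mod_ideal n (factor n f i)"
    "poly_mod.Mp (int n) (cofactor n f i * factor n f i) = cofactor n f (i - 1)"
proof -
  interpret poly_mod "int n" .
  let ?F = "factor n f i" and ?f = "cofactor n f (i - 1)"
  have "gcmd_exists n (frob_poly n i) ?f" using step i by (auto simp: factorization_step_def)
  then obtain h where "is_gcmd n (frob_poly n i) ?f h" by (auto simp: gcmd_exists_def)
  hence gcmd: "is_gcmd n (frob_poly n i) ?f ?F" using gcmd_eq[OF n] by (simp add: factor_def)
  hence mon: "monic_mod n ?F" and eq: "principal_ideal_mod n ?F = ideal_mod n (frob_poly n i) ?f"
    by (auto simp: is_gcmd_def)
  show "monic ?F" using mon by (simp add: monic_mod_def)
  have "Mp (1 * frob_poly n i + 0 * ?f) \<in> principal_ideal_mod n ?F"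
    unfolding eq ideal_mod_def by blast
  then obtain u where "Mp (frob_poly n i) = Mp (u * ?F)" by (auto simp: principal_ideal_mod_def)
  thus "frob_poly n i \<in> mod_ideal n ?F" by (intro mod_ideal_if_Mp_eq) (simp add: mult.commute)
  have "Mp (0 * frob_poly n i + 1 * ?f) \<in> principal_ideal_mod n ?F"
    unfolding eq ideal_mod_def by blast
  then obtain u where u: "?f = Mp (u * ?F)" using prev by (auto simp: principal_ideal_mod_def)
  have "quotient_mod n ?f ?F = Mp u"
    using u by (intro quotient_mod_unique n mon) simp_all
  moreover obtain k where "i = Suc k" using i by (cases i) auto
  ultimately have "cofactor n f i = Mp u" by (simp add: factor_def)
  thus "Mp (cofactor n f i * ?F) = ?f" using u by simp
qed

lemma Mp_cofactor:
  assumes "monic_mod n f"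
  shows "poly_mod.Mp (int n) (cofactor n f i) = cofactor n f i"
  using assms by (cases i) (simp_all add: monic_mod_def quotient_mod_def poly_mod.Mp_Mp)

lemma pseudoprime_factor_constant_term:
  assumes n: "n > 1" "odd n" and f: "monic_mod n f" and fact: "factorization_step f n"
    and frob: "frobenius_step f n" and i: "i \<in> {1..degree f}"
  shows "[coeff (factor n f i) 0 ^ n = coeff (factor n f i) 0] (mod int n)"
proof -
  let ?F = "factor n f i"
  note F = pseudoprime_factor[OF n(1) fact i Mp_cofactor[OF f]]
  have "pcompose ?F (monom 1 n) \<in> mod_ideal n ?F"
  proof (cases "i = 1")
    case True
    \<comment> \<open>The Frobenius step starts at 2. For \<open>i = 1\<close> its congruence
      follows from x^n \<equiv> x modulo the first factor.\<close>
    have "pcompose ?F (monom 1 n) - pcompose ?F (monom 1 1) \<in> mod_ideal n ?F"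
      using F(2) True by (intro mod_ideal_pcompose_diff) (simp add: frob_poly_def)
    moreover have "pcompose ?F (monom 1 1) = ?F"
    proof -
      have "monom 1 1 = ([:0, 1:] :: int poly)" by (simp add: monom_Suc)
      thus ?thesis by (simp only: pcompose_idR)
    qed
    moreover have "?F \<in> mod_ideal n ?F" by (rule mod_idealI[of _ _ 1 _ 0]) simp
    ultimately show ?thesis using mod_ideal_add by (metis diff_add_cancel)
  next
    case False
    hence "poly_mod.dvdm (int n) ?F (pcompose ?F (monom 1 n))"
      using frob i by (auto simp: frobenius_step_def)
    thus ?thesis by (auto simp: poly_mod.dvdm_def intro: mod_ideal_if_Mp_eq)
  qed
  hence "[((- 1) ^ degree ?F * coeff ?F 0) ^ n = (- 1) ^ degree ?F * coeff ?F 0] (mod int n)"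
    using F n i by (intro constant_term_cong) auto
  hence "[(- 1) ^ degree ?F * ((- 1) ^ degree ?F * coeff ?F 0) ^ n
      = (- 1) ^ degree ?F * ((- 1) ^ degree ?F * coeff ?F 0)] (mod int n)"
    by (intro cong_mult cong_refl)
  \<comment> \<open>Since \<open>n\<close> is odd, the sign passes unchanged through the power and
    cancels.\<close>
  moreover have "((- 1) ^ degree ?F) ^ n = ((- 1) ^ degree ?F :: int)"
    using n(2) by (cases "even (degree ?F)") auto
  hence "(- 1) ^ degree ?F * ((- 1) ^ degree ?F * coeff ?F 0) ^ n = coeff ?F 0 ^ n"
    by (simp add: power_mult_distrib flip: mult.assoc power_add)
  moreover have "(- 1) ^ degree ?F * ((- 1) ^ degree ?F * coeff ?F 0) = coeff ?F 0"
    by (simp flip: mult.assoc power_add)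
  ultimately show ?thesis by simp
qed

text \<open>Constant terms are multiplicative, and modulo \<open>n\<close> each cofactor is the
  product of the next cofactor and the next factor. At \<open>k = degree f\<close> the factorization
  step makes the last cofactor 1.\<close>

lemma coeff_0_cong_prod_factors:
  assumes n: "n > 1" and f: "monic_mod n f" and fact: "factorization_step f n" and k: "k \<le> degree f"
  shows "[coeff f 0 = (\<Prod>i=1..k. coeff (factor n f i) 0) * coeff (cofactor n f k) 0] (mod int n)"
  using k
proof (induction k)
  case (Suc k)
  interpret poly_mod "int n" .
  have "Mp (cofactor n f (Suc k) * factor n f (Suc k)) = Mp (cofactor n f k)"
    using pseudoprime_factor(3)[OF n fact, of "Suc k"] Mp_cofactor[OF f] Suc.prems by simp
  from arg_cong[OF this, of "\<lambda>p. coeff p 0"]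
  have "[coeff (cofactor n f k) 0 = coeff (cofactor n f (Suc k)) 0 * coeff (factor n f (Suc k)) 0] (mod int n)"
    by (simp add: Mp_coeff M_def unique_euclidean_semiring_class.cong_def coeff_mult_0 del: cofactor.simps)
  hence "[(\<Prod>i=1..k. coeff (factor n f i) 0) * coeff (cofactor n f k) 0 =
     (\<Prod>i=1..k. coeff (factor n f i) 0) * (coeff (cofactor n f (Suc k)) 0 * coeff (factor n f (Suc k)) 0)] (mod int n)"
    by (intro cong_mult cong_refl)
  with Suc have "[coeff f 0 = (\<Prod>i=1..k. coeff (factor n f i) 0) *
      (coeff (cofactor n f (Suc k)) 0 * coeff (factor n f (Suc k)) 0)] (mod int n)"
    by (meson Suc_leD cong_trans)
  thus ?case by (simp add: mult_ac del: cofactor.simps)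
qed simp

lemma coprime_iff_coprime_int:
  "Unique_Factorization.comm_monoid_mult_class.coprime a b \<longleftrightarrow> coprime a (b :: int)"
  by (simp add: Unique_Factorization.comm_monoid_mult_class.coprime_def' Rings.algebraic_semidom_class.coprime_def)

lemma coeff_Mp_bounds:
  assumes "monic_mod n f" "n > 0"
  shows "0 \<le> coeff f i" "coeff f i < int n"
proof -
  have "coeff f i = coeff f i mod int n"
    using assms by (metis monic_mod_def poly_mod.Mp_coeff poly_mod.M_def)
  thus "0 \<le> coeff f i" "coeff f i < int n"
    using assms pos_mod_bound[of "int n"] pos_mod_sign[of "int n"] by (metis of_nat_0_less_iff)+
qed

text \<open>The product \<open>P\<close> of the constant terms of the factors satisfies
  \<open>P ^ n \<equiv> P\<close> and agrees with the constant term of \<open>f\<close> modulo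
  \<open>n\<close>; the latter is a unit, so one factor cancels.\<close>

lemma frobenius_pseudoprime_constant_term:
  assumes "frobenius_pseudoprime f n"
  shows "nat (coeff f 0) \<in> fermat_bases n"
proof -
  have n: "n > 1" "odd n" and f: "monic_mod n f" and fact: "factorization_step f n"
    and frob: "frobenius_step f n"
    and "coprime (int n) (poly f 0 * discriminant f)"
    using assms by (auto simp: frobenius_pseudoprime_def coprime_iff_coprime_int)
  hence cop: "coprime (coeff f 0) (int n)"
    by (simp add: poly_0_coeff_0 ac_simps)
  define P where "P = (\<Prod>i=1..degree f. coeff (factor n f i) 0)"
  have "cofactor n f (degree f) = 1" using fact by (simp add: factorization_step_def)
  hence cP: "[coeff f 0 = P] (mod int n)"
    using coeff_0_cong_prod_factors[OF n(1) f fact order.refl] by (simp add: P_def)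
  have "[P ^ n = P] (mod int n)"
    unfolding P_def prod_power_distrib
    by (intro cong_prod pseudoprime_factor_constant_term n f fact frob) auto
  hence "[coeff f 0 ^ n = coeff f 0] (mod int n)"
    using cP by (meson cong_pow cong_sym cong_trans)
  hence "[coeff f 0 * coeff f 0 ^ (n - 1) = coeff f 0 * 1] (mod int n)"
    using n by (simp flip: power_Suc)
  hence *: "[coeff f 0 ^ (n - 1) = 1] (mod int n)"
    using cop by (simp only: cong_mult_lcancel)
  define a where "a = nat (coeff f 0)"
  have a: "coeff f 0 = int a" "a < n" using coeff_Mp_bounds[OF f, of 0] n by (auto simp: a_def)
  have "coprime a n" using cop a by simp
  moreover from this have "a \<noteq> 0" using n by (intro notI) simp
  moreover have "[int (a ^ (n - 1)) = int 1] (mod int n)" using * a by simp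
  hence "[a ^ (n - 1) = 1] (mod n)" by (simp only: cong_int_iff)
  ultimately show ?thesis using a by (simp add: a_def [symmetric] fermat_bases_def totatives_def)
qed

text \<open>A monic polynomial of degree \<open>d\<close> is determined by its constant term, here a
  Fermat base, and its \<open>d - 1\<close> middle coefficients; \<open>restrict\<close> places
  these in a finite extensional product.\<close>

lemma L_le:
  assumes d: "d \<ge> 1"
  shows "L d n \<le> n ^ (d - 1) * card (fermat_bases n)"
proof -
  let ?S = "{f. monic_mod n f \<and> degree f = d \<and> frobenius_pseudoprime f n}"
  let ?T = "fermat_bases n \<times> ({1..<d} \<rightarrow>\<^sub>E {0..<int n})"
  let ?h = "\<lambda>f :: int poly. (nat (coeff f 0), restrict (coeff f) {1..<d})"
  have "card ?S \<le> card ?T"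
  proof (rule card_inj_on_le)
    show "inj_on ?h ?S"
    proof (rule inj_onI)
      fix f g assume f: "f \<in> ?S" and g: "g \<in> ?S" and eq: "?h f = ?h g"
      hence n: "n > 1" by (auto simp: frobenius_pseudoprime_def)
      show "f = g"
      proof (rule poly_eqI)
        fix i
        consider "i = 0" | "i \<in> {1..<d}" | "i = d" | "i > d" by fastforce
        thus "coeff f i = coeff g i"
        proof cases
          case 1
          thus ?thesis using eq f g n coeff_Mp_bounds(1)[of n f 0] coeff_Mp_bounds(1)[of n g 0] by auto
        next
          case 2
          from eq have "restrict (coeff f) {1..<d} i = restrict (coeff g) {1..<d} i" by simp
          thus ?thesis using 2 by simp
        qed (use f g in \<open>auto simp: monic_mod_def coeff_eq_0\<close>)
      qed
    qed
    show "?h ` ?S \<subseteq> ?T"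
    proof (intro image_subsetI SigmaI)
      fix f assume f: "f \<in> ?S"
      hence n: "n > 1" by (auto simp: frobenius_pseudoprime_def)
      show "nat (coeff f 0) \<in> fermat_bases n" using f by (auto intro: frobenius_pseudoprime_constant_term)
      show "restrict (coeff f) {1..<d} \<in> {1..<d} \<rightarrow>\<^sub>E {0..<int n}"
        using coeff_Mp_bounds[of n f] f n by auto
    qed
    show "finite ?T" by (auto intro: finite_PiE)
  qed
  also have "\<dots> = n ^ (d - 1) * card (fermat_bases n)"
    by (simp add: card_cartesian_product card_PiE mult.commute)
  finally show ?thesis by (simp add: L_def)
qed

text \<open>For a base \<open>a\<close>, the polynomial x + a divides x^n - x modulo
  \<open>n\<close>, so the first gcmd is x + a itself and the cofactor is 1. Its discriminant is 1,
  and the other two steps hold trivially.\<close>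

lemma card_fermat_bases_le_L_1:
  assumes n: "n > 1" "odd n"
  shows "card (fermat_bases n) \<le> L 1 n"
proof -
  interpret poly_mod "int n" .
  let ?S = "{f. monic_mod n f \<and> degree f = 1 \<and> frobenius_pseudoprime f n}"
  let ?h = "\<lambda>a. [:int a, 1:]"
  have "card (fermat_bases n) \<le> card ?S"
  proof (rule card_inj_on_le)
    show "inj_on ?h (fermat_bases n)" by (rule inj_onI) simp
    show "?h ` fermat_bases n \<subseteq> ?S"
    proof (rule image_subsetI)
      fix a assume a: "a \<in> fermat_bases n"
      define f where "f = ?h a"
      have cop: "coprime a n" and "a \<le> n" and pow: "[a ^ (n - 1) = 1] (mod n)"
        using a by (auto simp: fermat_bases_def totatives_def)
      have "a \<noteq> n" using cop n by auto
      with \<open>a \<le> n\<close> have "a < n" by simp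
      have deg: "degree f = 1" by (simp add: f_def)
      have Mpf: "Mp f = f"
        using \<open>a < n\<close> n by (intro poly_eqI) (auto simp: Mp_coeff M_def f_def coeff_pCons split: nat.splits)
      hence mon: "monic_mod n f" by (simp add: monic_mod_def f_def)
      have "discriminant f = 1" by (simp add: discriminant_def f_def pderiv_pCons)
      have "[int a ^ (n - 1) = 1] (mod int n)"
        using pow by (metis cong_int_iff of_nat_1 of_nat_power)
      hence "[int a * int a ^ (n - 1) = int a * 1] (mod int n)" by (intro cong_mult cong_refl)
      hence "[int a ^ n = int a] (mod int n)" using n by (simp flip: power_Suc)
      then obtain k where k: "int a ^ n - int a = int n * k" by (auto simp: cong_iff_dvd_diff)
      have "poly (frob_poly n 1) (- int a) = - (int a ^ n - int a)"
        using n by (simp add: frob_poly_def poly_monom)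
      also have "\<dots> = int n * (- k)" by (simp add: k)
      \<comment> \<open>Adding the constant \<open>int n * k\<close> makes \<open>- int a\<close> an
        exact root, so the factor theorem over the integers applies.\<close>
      finally have "poly (frob_poly n 1 + [:int n * k:]) (- int a) = 0" by simp
      hence "[:- (- int a), 1:] dvd frob_poly n 1 + [:int n * k:]" by (simp only: poly_eq_0_iff_dvd)
      then obtain q where q: "frob_poly n 1 + [:int n * k:] = f * q"
        unfolding f_def minus_minus by (rule dvdE)
      have Mp_frob: "Mp (frob_poly n 1) = Mp (f * q)"
        unfolding Mp_eq_iff q [symmetric] by (intro exI[of _ "[:- k:]"]) simp
      have "is_gcmd n (frob_poly n 1) f f"
        unfolding is_gcmd_def
      proof (intro conjI mon equalityI subsetI)
        fix g assume "g \<in> principal_ideal_mod n f"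
        then obtain u where "g = Mp (0 * frob_poly n 1 + u * f)" by (auto simp: principal_ideal_mod_def)
        thus "g \<in> ideal_mod n (frob_poly n 1) f" unfolding ideal_mod_def by blast
      next
        fix g assume "g \<in> ideal_mod n (frob_poly n 1) f"
        then obtain u v where "g = Mp (u * frob_poly n 1 + v * f)" by (auto simp: ideal_mod_def)
        also have "\<dots> = Mp (u * Mp (frob_poly n 1) + v * f)"
          by (metis mult_Mp(2) plus_Mp(1))
        also have "\<dots> = Mp (u * (f * q) + v * f)"
          unfolding Mp_frob by (metis mult_Mp(2) plus_Mp(1))
        also have "\<dots> = Mp ((u * q + v) * f)" by (simp add: algebra_simps)
        finally show "g \<in> principal_ideal_mod n f" unfolding principal_ideal_mod_def by blast
      qed
      moreover from this have gcmd: "gcmd n (frob_poly n 1) f = f" by (rule gcmd_eq[OF n(1)])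
      moreover have "quotient_mod n f f = 1"
        using n Mpf by (intro quotient_mod_unique n(1) mon) (auto simp: Mp_def M_def)
      ultimately have fact: "factorization_step f n"
        by (auto simp: factorization_step_def deg gcmd_exists_def)
      have no_even: "{i. i \<in> {1..degree f} \<and> even i} = {}" by (auto simp: deg)
      have "Jacobi 1 n = 1"
      proof -
        have "Legendre 1 (int p) = 1" if "p \<in># prime_factorization n" for p
        proof -
          have "p > 1" using that prime_gt_1_nat[of p] by auto
          moreover have "QuadRes (int p) 1" unfolding QuadRes_def by (intro exI[of _ 1]) simp
          ultimately show ?thesis by (simp add: Legendre_def unique_euclidean_semiring_class.cong_def)
        qed
        thus ?thesis by (simp add: Jacobi_def cong: image_mset_cong)
      qed
      hence "jacobi_step f n"
        unfolding jacobi_step_def \<open>discriminant f = 1\<close> no_even by simp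
      moreover have "frobenius_step f n" by (simp add: frobenius_step_def deg)
      moreover have "coprime (int n) (poly f 0 * discriminant f)"
        using cop \<open>discriminant f = 1\<close> by (simp add: f_def ac_simps)
      ultimately have "frobenius_pseudoprime f n"
        using n mon fact by (simp add: frobenius_pseudoprime_def coprime_iff_coprime_int)
      thus "?h a \<in> ?S" using mon deg by (simp add: f_def)
    qed
    show "finite ?S"
    proof (rule finite_subset)
      show "?S \<subseteq> (\<lambda>a. [:a, 1:]) ` {0..<int n}"
      proof
        fix f assume f: "f \<in> ?S"
        hence "f = [:coeff f 0, 1:]"
          by (intro poly_eqI) (auto simp: coeff_pCons monic_mod_def coeff_eq_0 split: nat.splits)
        moreover have "coeff f 0 \<in> {0..<int n}" using f coeff_Mp_bounds[of n f 0] n by auto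
        ultimately show "f \<in> (\<lambda>a. [:a, 1:]) ` {0..<int n}" by blast
      qed
    qed simp
  qed
  thus ?thesis by (simp add: L_def)
qed

lemma L_1_eq: "n > 1 \<Longrightarrow> odd n \<Longrightarrow> L 1 n = card (fermat_bases n)"
  using L_le[of 1 n] card_fermat_bases_le_L_1[of n] by simp

theorem theorem5p3:
  fixes d :: nat
  assumes "d \<ge> 1"
  shows "(\<forall>x::real. (\<Sum>n\<in>odd_composites_below x. real (L d n))
             \<le> x ^ (d - 1) * (\<Sum>n\<in>odd_composites_below x. real (L 1 n))) \<and>
         (\<exists>\<epsilon>::real \<Rightarrow> real. (\<epsilon> \<longlongrightarrow> 0) at_top \<and>
            (\<forall>\<^sub>F x in at_top.
               x ^ (d - 1) * (\<Sum>n\<in>odd_composites_below x. real (L 1 n))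
                 \<le> x ^ (d + 1) * script_L x powr (- 1 + \<epsilon> x)))"
proof (intro conjI allI)
  fix x :: real
  have "real (L d n) \<le> x ^ (d - 1) * real (L 1 n)" if "n \<in> odd_composites_below x" for n
  proof -
    have n: "n > 1" "odd n" "real n < x" using that by (auto simp: odd_composites_below_def)
    have "real (L d n) \<le> real (n ^ (d - 1) * L 1 n)"
      unfolding L_1_eq[OF n(1,2)] by (intro of_nat_mono L_le assms)
    also have "\<dots> \<le> x ^ (d - 1) * real (L 1 n)"
      using n by (auto intro!: mult_right_mono power_mono)
    finally show ?thesis .
  qed
  thus "(\<Sum>n\<in>odd_composites_below x. real (L d n))
      \<le> x ^ (d - 1) * (\<Sum>n\<in>odd_composites_below x. real (L 1 n))"
    by (simp add: sum_distrib_left sum_mono)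
next
  let ?S = "\<lambda>x. \<Sum>n\<in>odd_composites_below x. real (L 1 n)"
  have le: "?S x \<le> (\<Sum>n | n > 1 \<and> \<not> prime n \<and> real n < x. real (card (fermat_bases n)))" for x
  proof -
    have "?S x = (\<Sum>n\<in>odd_composites_below x. real (card (fermat_bases n)))"
      by (intro sum.cong) (auto simp: odd_composites_below_def L_1_eq simp del: One_nat_def)
    also have "\<dots> \<le> (\<Sum>n | n > 1 \<and> \<not> prime n \<and> real n < x. real (card (fermat_bases n)))"
    proof (rule sum_mono2)
      show "finite {n. n > 1 \<and> \<not> prime n \<and> real n < x}"
        by (rule finite_subset[of _ "{..nat \<lceil>x\<rceil>}"]) (auto, linarith)
    qed (auto simp: odd_composites_below_def)
    finally show ?thesis .
  qed
  have bound: "\<forall>\<^sub>F x in at_top. ?S x \<le> x\<^sup>2 * script_L x powr (- 1 + \<epsilon>)" if "\<epsilon> > 0" for \<epsilon>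
  proof -
    \<comment> \<open>The asymptotic bound needs \<open>\<eta> < 1\<close> and has exponent
      \<open>- 1 + 2 * \<eta>\<close>.\<close>
    define \<eta> where "\<eta> = min (1 / 2) (\<epsilon> / 2)"
    have \<eta>: "0 < \<eta>" "\<eta> < 1" "2 * \<eta> \<le> \<epsilon>" using that by (auto simp: \<eta>_def)
    have "\<forall>\<^sub>F x in at_top. script_L x > 1" unfolding script_L_def by real_asymp
    with eventually_sum_card_fermat_bases_le[OF \<eta>(1,2)] show ?thesis
    proof eventually_elim
      case (elim x)
      have "script_L x powr (- 1 + 2 * \<eta>) \<le> script_L x powr (- 1 + \<epsilon>)"
        using elim \<eta> by (intro powr_mono) auto
      hence "x\<^sup>2 * script_L x powr (- 1 + 2 * \<eta>) \<le> x\<^sup>2 * script_L x powr (- 1 + \<epsilon>)"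
        by (intro mult_left_mono) auto
      with elim le[of x] show ?case by linarith
    qed
  qed
  have "\<forall>\<^sub>F x::real in at_top. x\<^sup>2 > 0" "\<forall>\<^sub>F x in at_top. script_L x > 1"
    unfolding script_L_def by real_asymp+
  then obtain \<epsilon> where \<epsilon>: "(\<epsilon> \<longlongrightarrow> 0) at_top"
    "\<forall>\<^sub>F x in at_top. ?S x \<le> x\<^sup>2 * script_L x powr (- 1 + \<epsilon> x)"
    using exists_o1_exponent[of ?S "\<lambda>x. x\<^sup>2" script_L, OF sum_nonneg _ _ bound] by force
  have "\<forall>\<^sub>F x in at_top. x ^ (d - 1) * ?S x \<le> x ^ (d + 1) * script_L x powr (- 1 + \<epsilon> x)"
    using \<epsilon>(2) eventually_ge_at_top[of 0]
  proof eventually_elim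
    case (elim x)
    have "x ^ (d - 1) * ?S x \<le> x ^ (d - 1) * (x\<^sup>2 * script_L x powr (- 1 + \<epsilon> x))"
      using elim by (intro mult_left_mono) auto
    also have "\<dots> = x ^ (d + 1) * script_L x powr (- 1 + \<epsilon> x)"
      using assms by (simp flip: power_add mult.assoc)
    finally show ?case .
  qed
  with \<epsilon>(1) show "\<exists>\<epsilon>. (\<epsilon> \<longlongrightarrow> 0) at_top \<and> (\<forall>\<^sub>F x in at_top.
      x ^ (d - 1) * ?S x \<le> x ^ (d + 1) * script_L x powr (- 1 + \<epsilon> x))" by blast
qed

end
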